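(* Any quantum algorithm that, given oracle access to an unknown quantum $k$-junta $U$ on $n\ge k$ qubits, outputs with constant success probability a classical description of a unitary $V$ with $\mathrm{dist}(U,V)\le\varepsilon$ (learning quantum $k$-juntas with error $\varepsilon$) must make $\Omega\!\left(4^k\log(1/\varepsilon)/k\right)$ queries to $U$.
   Context: $N=2^n$, $\mathcal{U}_N$ is the set of $N\times N$ unitaries. A unitary $U\in\mathcal{U}_N$ is a quantum $k$-junta if $U=V_S\otimes I_{\overline{S}}$ for some $S\subseteq[n]$ with $|S|=k$ and some $V_S\in\mathcal{U}_{2^k}$ acting on the qubits in $S$. For $A,B\in\mathbb{C}^{N\times N}$, $\mathrm{dist}(A,B):=\min_{\theta\in[0,2\pi)}\frac{1}{\sqrt{2N}}\|e^{i\theta}A-B\|$ with $\|\cdot\|$ the Frobenius norm. An oracle query applies $U$ to a quantum state. *)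

theory Defs
  imports "HOL-Analysis.Analysis" "Jordan_Normal_Form.Schur_Decomposition"
begin

text \<open>Computational basis states of m qubits are indices x < 2^m; qubit i of x is bit i.\<close>

definition qbit :: "nat \<Rightarrow> nat \<Rightarrow> bool" where
  "qbit x i = odd (x div 2 ^ i)"

definition restr :: "nat set \<Rightarrow> nat \<Rightarrow> nat" where
  "restr S x = (\<Sum>j<card S. (if qbit x (sorted_list_of_set S ! j) then 2 ^ j else 0))"

definition unitary_mat :: "nat \<Rightarrow> complex mat \<Rightarrow> bool" where
  "unitary_mat d U \<longleftrightarrow> U \<in> carrier_mat d d \<and> U * mat_adjoint U = 1\<^sub>m d"

text \<open>V_S \<otimes> I: the 2^m x 2^m matrix acting as V on the qubits in S and as the identity
  on the remaining qubits of the m-qubit system.\<close>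
definition act_on :: "nat \<Rightarrow> nat set \<Rightarrow> complex mat \<Rightarrow> complex mat" where
  "act_on m S V = mat (2 ^ m) (2 ^ m) (\<lambda>(x, y).
      if (\<forall>i<m. i \<notin> S \<longrightarrow> qbit x i = qbit y i) then V $$ (restr S x, restr S y) else 0)"

definition quantum_junta :: "nat \<Rightarrow> nat \<Rightarrow> complex mat \<Rightarrow> bool" where
  "quantum_junta n k U \<longleftrightarrow>
     (\<exists>S V. S \<subseteq> {0..<n} \<and> card S = k \<and> unitary_mat (2 ^ k) V \<and> U = act_on n S V)"

definition frob_norm :: "complex mat \<Rightarrow> real" where
  "frob_norm A = sqrt (\<Sum>i<dim_row A. \<Sum>j<dim_col A. (cmod (A $$ (i, j)))\<^sup>2)"

text \<open>dist(A,B) = min over theta of (2N)^(-1/2) ||e^(i theta) A - B||_F (the minimum exists).\<close>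
definition udist :: "complex mat \<Rightarrow> complex mat \<Rightarrow> real" where
  "udist A B = (INF \<theta>\<in>{0..<2*pi}.
      frob_norm (exp (\<i> * of_real \<theta>) \<cdot>\<^sub>m A - B) / sqrt (2 * real (dim_row A)))"

text \<open>A T-query quantum algorithm for n-qubit oracles: it works on m >= n qubits, starts in
  |0...0>, applies the unitaries W 0, then (U \<otimes> I), W 1, (U \<otimes> I), ..., W T (the oracle U
  acting on the first n qubits), measures in the computational basis and, on outcome x,
  outputs (the classical description of) the unitary out x.  Intermediate measurements,
  ancillas, general POVMs and adaptivity are subsumed by this model.\<close>
definition query_alg :: "nat \<Rightarrow> nat \<Rightarrow> nat \<Rightarrow> (nat \<Rightarrow> complex mat) \<Rightarrow> (nat \<Rightarrow> complex mat) \<Rightarrow> bool" where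
  "query_alg n m T W out \<longleftrightarrow> n \<le> m \<and> (\<forall>t\<le>T. unitary_mat (2 ^ m) (W t))
     \<and> (\<forall>x<2 ^ m. unitary_mat (2 ^ n) (out x))"

fun alg_state :: "nat \<Rightarrow> nat \<Rightarrow> (nat \<Rightarrow> complex mat) \<Rightarrow> complex mat \<Rightarrow> nat \<Rightarrow> complex vec" where
  "alg_state n m W U 0 = W 0 *\<^sub>v unit_vec (2 ^ m) 0"
| "alg_state n m W U (Suc t) = W (Suc t) *\<^sub>v (act_on m {0..<n} U *\<^sub>v alg_state n m W U t)"

definition success_prob :: "nat \<Rightarrow> nat \<Rightarrow> nat \<Rightarrow> (nat \<Rightarrow> complex mat) \<Rightarrow> (nat \<Rightarrow> complex mat)
    \<Rightarrow> complex mat \<Rightarrow> real \<Rightarrow> real" where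
  "success_prob n m T W out U eps =
     (\<Sum>x\<in>{x. x < 2 ^ m \<and> udist U (out x) \<le> eps}. (cmod (alg_state n m W U T $ x))\<^sup>2)"

end

theory Submission
  imports Defs
begin

text \<open>
  Let \<open>d = 2 ^ k\<close>. Expanding every oracle call \<open>V = \<Sum> V\<^sub>a\<^sub>b E\<^sub>a\<^sub>b\<close> in matrix units writes the final state
  after \<open>T\<close> queries as a sum of \<open>d ^ (2T)\<close> fixed vectors with coefficients depending on \<open>V\<close>. Both the
  coefficients and the vectors have total squared norm \<open>d ^ T\<close>, so by Cauchy-Schwarz the final
  probabilities are dominated, simultaneously for all \<open>V\<close>, by one distribution of mass \<open>4 ^ (kT)\<close>.
  Hence if every output is \<open>\<epsilon>\<close>-close to at most \<open>L\<close> members of a family of \<open>M\<close> juntas, then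
  \<open>p M \<le> L 4 ^ (kT)\<close>.

  The family consists of real orthogonal matrices. With \<open>h = d / 2\<close>, the first \<open>h\<close> columns are chosen
  successively by Householder reflections, column \<open>j\<close> being the image under the previous reflections of
  a unit vector whose coordinates \<open>h, \<dots>, 2h - 1\<close> run through a grid with \<open>q ^ h\<close> points,
  \<open>q \<approx> 1 / (8\<epsilon>)\<close>. So \<open>M = q ^ (h\<^sup>2)\<close>. Balls of radius of order \<open>\<epsilon>\<close> are counted by a Gaussian sum over the
  family, which is summed column by column because the previous reflections are isometries; this gives
  \<open>L \<le> 2 \<cdot> 8 ^ (h\<^sup>2)\<close>.
\<close>

section \<open>A well-spread family of orthogonal matrices\<close>

text \<open>Peeling off the head letter costs one factor \<open>K\<close>. The same induction later
  bounds the Gaussian weights of frames, the word coefficients and the path amplitudes.\<close>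

lemma sum_over_lists_le:
  fixes F :: "'a list \<Rightarrow> real"
  assumes "finite Z" "F [] \<le> 1" "0 \<le> K"
    and step: "\<And>zs. set zs \<subseteq> Z \<Longrightarrow> length zs < n \<Longrightarrow> (\<Sum>z\<in>Z. F (z # zs)) \<le> K * F zs"
  shows "(\<Sum>zs | set zs \<subseteq> Z \<and> length zs = n. F zs) \<le> K ^ n"
  using step
proof (induction n)
  case 0
  have "{zs::'a list. set zs \<subseteq> Z \<and> length zs = 0} = {[]}" by auto
  then show ?case using assms(2) by simp
next
  case (Suc n)
  let ?L = "{zs. set zs \<subseteq> Z \<and> length zs = n}"
  have eq: "{zs. set zs \<subseteq> Z \<and> length zs = Suc n} = (\<lambda>(zs, z). z # zs) ` (?L \<times> Z)"
    by (force simp: length_Suc_conv image_iff)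
  have "(\<Sum>zs | set zs \<subseteq> Z \<and> length zs = Suc n. F zs) = (\<Sum>zs\<in>?L. \<Sum>z\<in>Z. F (z # zs))"
    unfolding eq by (subst sum.reindex) (auto simp: inj_on_def sum.cartesian_product case_prod_unfold)
  also have "\<dots> \<le> (\<Sum>zs\<in>?L. K * F zs)"
    by (intro sum_mono Suc.prems) auto
  also have "\<dots> = K * (\<Sum>zs\<in>?L. F zs)"
    by (simp add: sum_distrib_left)
  also have "\<dots> \<le> K * K ^ n"
    using Suc.IH Suc.prems assms(3) by (intro mult_left_mono) auto
  finally show ?case by simp
qed

lemma sum_half_powers_le:
  fixes A :: "nat set"
  assumes "finite A"
  shows "(\<Sum>i\<in>A. (1/2) ^ i) \<le> (2::real)"
proof -
  have "(\<Sum>i\<in>A. (1/2::real) ^ i) \<le> (\<Sum>i. (1/2) ^ i)"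
    using assms by (intro sum_le_suminf summable_geometric) auto
  also have "\<dots> = 2" by (subst suminf_geometric) auto
  finally show ?thesis .
qed

text \<open>Since \<open>n \<le> n ^ 2\<close> for naturals, Gaussian tails can be replaced by
  geometric ones.\<close>

lemma powr_neg_square_le:
  fixes x :: real
  assumes "real n \<le> \<bar>x\<bar>"
  shows "2 powr - x\<^sup>2 \<le> (1/2) ^ n"
proof -
  have "real n \<le> real (n ^ 2)"
    by (intro of_nat_mono) (simp add: power2_eq_square)
  also have "\<dots> \<le> \<bar>x\<bar> ^ 2" using assms power_mono[of "real n" "\<bar>x\<bar>" 2] by simp
  finally have "2 powr - x\<^sup>2 \<le> 2 powr - real n" by simp
  also have "\<dots> = (1/2) ^ n" by (simp add: powr_minus powr_realpow power_one_over inverse_eq_divide)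
  finally show ?thesis .
qed

text \<open>On either side of \<open>a\<close> the integers lie at distances at least 0, 1, 2, ...,
  so each side is dominated by a geometric series of sum 2, uniformly in \<open>q\<close> and
  \<open>a\<close>.\<close>

lemma theta_sum_le:
  "(\<Sum>t<q. 2 powr - (real t - a)\<^sup>2) \<le> (4::real)"
proof -
  \<comment> \<open>For negative \<open>a\<close> the truncation gives \<open>m = 0\<close>, which
    leaves the second sum below empty; whenever \<open>t < m\<close>, no truncation took
    place.\<close>
  define m where "m = nat \<lceil>a\<rceil>"
  have "(\<Sum>t<q. 2 powr - (real t - a)\<^sup>2) =
      (\<Sum>t\<in>{..<q} \<inter> {m..}. 2 powr - (real t - a)\<^sup>2) + (\<Sum>t\<in>{..<q} - {m..}. 2 powr - (real t - a)\<^sup>2)"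
    by (intro sum.Int_Diff) auto
  also have "\<dots> \<le> (\<Sum>t\<in>{..<q} \<inter> {m..}. (1/2) ^ (t - m)) + (\<Sum>t\<in>{..<q} - {m..}. (1/2) ^ (m - 1 - t))"
  proof (intro add_mono sum_mono powr_neg_square_le)
    fix t assume "t \<in> {..<q} \<inter> {m..}"
    then have "m \<le> t" by auto
    moreover have "a \<le> real m" unfolding m_def by linarith
    ultimately show "real (t - m) \<le> \<bar>real t - a\<bar>" by (simp add: of_nat_diff)
  next
    fix t assume "t \<in> {..<q} - {m..}"
    then have "t < m" by auto
    moreover from this have "real m - 1 < a" unfolding m_def by linarith
    ultimately show "real (m - 1 - t) \<le> \<bar>real t - a\<bar>" by (simp add: of_nat_diff)
  qed
  also have "(\<Sum>t\<in>{..<q} \<inter> {m..}. (1/2::real) ^ (t - m)) = (\<Sum>i\<in>(\<lambda>t. t - m) ` ({..<q} \<inter> {m..}). (1/2) ^ i)"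
    by (subst sum.reindex) (auto simp: inj_on_def)
  also have "(\<Sum>t\<in>{..<q} - {m..}. (1/2::real) ^ (m - 1 - t)) = (\<Sum>i\<in>(\<lambda>t. m - 1 - t) ` ({..<q} - {m..}). (1/2) ^ i)"
    by (subst sum.reindex) (auto simp: inj_on_def)
  finally show ?thesis
    using sum_half_powers_le[of "(\<lambda>t. t - m) ` ({..<q} \<inter> {m..})"]
      sum_half_powers_le[of "(\<lambda>t. m - 1 - t) ` ({..<q} - {m..})"] by auto
qed

text \<open>The Gaussian weight factorises over the coordinates.\<close>

lemma grid_theta_sum_le:
  "(\<Sum>z\<in>{..<h} \<rightarrow>\<^sub>E {..<q}. 2 powr - (\<Sum>l<h. (real (z l) - a l)\<^sup>2)) \<le> (4::real) ^ h"
proof -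
  have "(\<Sum>z\<in>{..<h} \<rightarrow>\<^sub>E {..<q}. 2 powr - (\<Sum>l<h. (real (z l) - a l)\<^sup>2)) =
      (\<Sum>z\<in>{..<h} \<rightarrow>\<^sub>E {..<q}. \<Prod>l<h. 2 powr - (real (z l) - a l)\<^sup>2)"
    by (simp add: powr_sum flip: sum_negf)
  also have "\<dots> = (\<Prod>l<h. \<Sum>t<q. 2 powr - (real t - a l)\<^sup>2)"
    by (subst prod_sum_PiE) auto
  also have "\<dots> \<le> (\<Prod>l<h. 4)"
    by (intro prod_mono conjI sum_nonneg theta_sum_le) auto
  finally show ?thesis by simp
qed

section \<open>Real orthogonal matrices as isometries\<close>

definition real_orthogonal_mat :: "nat \<Rightarrow> real mat \<Rightarrow> bool" where
  "real_orthogonal_mat d A \<longleftrightarrow> A \<in> carrier_mat d d \<and> A * transpose_mat A = 1\<^sub>m d"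

lemma real_orthogonal_mat_rows:
  assumes "real_orthogonal_mat d A" "i < d" "j < d"
  shows "(\<Sum>l<d. A $$ (i, l) * A $$ (j, l)) = (if i = j then 1 else 0)"
proof -
  have "(A * transpose_mat A) $$ (i, j) = (\<Sum>l<d. A $$ (i, l) * A $$ (j, l))"
    using assms(2,3) carrier_matD[of A d d] assms(1)[unfolded real_orthogonal_mat_def]
    by (subst index_mult_mat) (auto simp: scalar_prod_def lessThan_atLeast0)
  moreover have "(A * transpose_mat A) $$ (i, j) = (if i = j then 1 else 0)"
    using assms unfolding real_orthogonal_mat_def by simp
  ultimately show ?thesis by simp
qed

lemma real_orthogonal_mat_transpose:
  assumes "real_orthogonal_mat d A" shows "real_orthogonal_mat d (transpose_mat A)"
  using assms mat_mult_left_right_inverse[of A d "transpose_mat A"] unfolding real_orthogonal_mat_def by auto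

lemma real_orthogonal_mat_mult:
  assumes "real_orthogonal_mat d A" "real_orthogonal_mat d B"
  shows "real_orthogonal_mat d (A * B)"
proof -
  have A: "A \<in> carrier_mat d d" "A * transpose_mat A = 1\<^sub>m d"
    and B: "B \<in> carrier_mat d d" "B * transpose_mat B = 1\<^sub>m d"
    using assms unfolding real_orthogonal_mat_def by auto
  have "(A * B) * transpose_mat (A * B) = (A * B) * (transpose_mat B * transpose_mat A)"
    using transpose_mult[OF A(1) B(1)] by simp
  also have "\<dots> = A * ((B * transpose_mat B) * transpose_mat A)"
    using A(1) B(1) by (simp add: assoc_mult_mat[of _ d d _ d _ d])
  also have "\<dots> = 1\<^sub>m d" using A B by simp
  finally show ?thesis using A B unfolding real_orthogonal_mat_def by auto
qed

lemma real_orthogonal_mat_sum_squares: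
  assumes "real_orthogonal_mat d A"
  shows "(\<Sum>i<d. \<Sum>j<d. (A $$ (i, j))\<^sup>2) = real d"
  using real_orthogonal_mat_rows[OF assms] by (simp add: power2_eq_square)

lemma real_orthogonal_mat_norm:
  assumes "real_orthogonal_mat d A"
  shows "(\<Sum>i<d. (\<Sum>l<d. A $$ (i, l) * f l)\<^sup>2) = (\<Sum>l<d. (f l)\<^sup>2)"
proof -
  have c: "(\<Sum>i<d. A $$ (i, l) * A $$ (i, m)) = (if l = m then 1 else 0)" if "l < d" "m < d" for l m
    using real_orthogonal_mat_rows[OF real_orthogonal_mat_transpose[OF assms] that] that assms
    unfolding real_orthogonal_mat_def by auto
  have "(\<Sum>i<d. (\<Sum>l<d. A $$ (i, l) * f l)\<^sup>2) = (\<Sum>i<d. \<Sum>l<d. \<Sum>m<d. f l * f m * (A $$ (i, l) * A $$ (i, m)))"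
    by (simp add: power2_eq_square sum_product mult_ac)
  also have "\<dots> = (\<Sum>l<d. \<Sum>i<d. \<Sum>m<d. f l * f m * (A $$ (i, l) * A $$ (i, m)))"
    by (rule sum.swap)
  also have "\<dots> = (\<Sum>l<d. \<Sum>m<d. \<Sum>i<d. f l * f m * (A $$ (i, l) * A $$ (i, m)))"
    by (intro sum.cong refl sum.swap)
  also have "\<dots> = (\<Sum>l<d. \<Sum>m<d. f l * f m * (if l = m then 1 else 0))"
    by (intro sum.cong refl) (simp add: sum_distrib_left[symmetric] c)
  also have "\<dots> = (\<Sum>l<d. (f l)\<^sup>2)" by (simp add: power2_eq_square if_distrib[of "\<lambda>x. _ * x"] cong: if_cong)
  finally show ?thesis .
qed

text \<open>The transpose is an isometry; applying it to \<open>A f - g\<close> moves the rotation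
  from the variable vector \<open>f\<close> to the fixed centre \<open>g\<close>.\<close>

lemma real_orthogonal_mat_dist:
  assumes "real_orthogonal_mat d A"
  shows "(\<Sum>i<d. ((\<Sum>l<d. A $$ (i, l) * f l) - g i)\<^sup>2) = (\<Sum>l<d. (f l - (\<Sum>i<d. A $$ (i, l) * g i))\<^sup>2)"
proof -
  have B: "real_orthogonal_mat d (transpose_mat A)" by (rule real_orthogonal_mat_transpose[OF assms])
  have car: "A \<in> carrier_mat d d" using assms unfolding real_orthogonal_mat_def by auto
  have c: "(\<Sum>i<d. A $$ (i, l) * A $$ (i, m)) = (if l = m then 1 else 0)" if "l < d" "m < d" for l m
    using real_orthogonal_mat_rows[OF B that] that car by auto
  have "(\<Sum>i<d. transpose_mat A $$ (l, i) * ((\<Sum>l<d. A $$ (i, l) * f l) - g i)) =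
      f l - (\<Sum>i<d. A $$ (i, l) * g i)" if l: "l < d" for l
  proof -
    have "(\<Sum>i<d. transpose_mat A $$ (l, i) * ((\<Sum>l<d. A $$ (i, l) * f l) - g i)) =
      (\<Sum>i<d. \<Sum>m<d. f m * (A $$ (i, l) * A $$ (i, m))) - (\<Sum>i<d. A $$ (i, l) * g i)"
      using car l by (simp add: algebra_simps sum_subtractf sum_distrib_left)
    also have "(\<Sum>i<d. \<Sum>m<d. f m * (A $$ (i, l) * A $$ (i, m))) = (\<Sum>m<d. \<Sum>i<d. f m * (A $$ (i, l) * A $$ (i, m)))"
      by (rule sum.swap)
    also have "\<dots> = (\<Sum>m<d. f m * (if l = m then 1 else 0))"
      by (intro sum.cong refl) (simp add: sum_distrib_left[symmetric] c l)
    also have "\<dots> = f l" using l by (simp add: if_distrib[of "\<lambda>x. _ * x"] cong: if_cong)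
    finally show ?thesis .
  qed
  then show ?thesis
    using real_orthogonal_mat_norm[OF B, of "\<lambda>i. (\<Sum>l<d. A $$ (i, l) * f l) - g i"] by simp
qed

text \<open>The reflection exchanging \<open>e\<^sub>j\<close> and the unit vector \<open>w\<close>. For \<open>w = e\<^sub>j\<close> the quotient is \<open>0 / 0 = 0\<close>, which correctly gives the identity.\<close>
definition householder :: "nat \<Rightarrow> nat \<Rightarrow> (nat \<Rightarrow> real) \<Rightarrow> real mat" where
  "householder d j w = mat d d (\<lambda>(a, b). of_bool (a = b)
     - (of_bool (a = j) - w a) * (of_bool (b = j) - w b) / (1 - w j))"

text \<open>With \<open>v = e_j - w\<close> and \<open>s = 1 / (1 - w j)\<close> the matrix is
  \<open>I - s v v^T\<close>. As \<open>w\<close> is a unit vector, \<open>v\<close> has squared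
  norm \<open>2 * (1 - w j)\<close>, so the quadratic term in \<open>s\<close> cancels the linear
  ones.\<close>

lemma householder_orthogonal:
  assumes j: "j < d" and w: "(\<Sum>i<d. (w i)\<^sup>2) = 1"
  shows "real_orthogonal_mat d (householder d j w)"
proof -
  define v where "v i = of_bool (i = j) - w i" for i
  define s where "s = 1 / (1 - w j)"
  have vv: "(\<Sum>i<d. v i * v i) = 2 * (1 - w j)"
  proof -
    have "(\<Sum>i<d. v i * v i) = (\<Sum>i<d. of_bool (i = j) * (1 - 2 * w i) + (w i)\<^sup>2)"
      by (intro sum.cong refl) (auto simp: v_def power2_eq_square algebra_simps)
    also have "\<dots> = (\<Sum>i<d. of_bool (i = j) * (1 - 2 * w i)) + 1"
      by (simp add: sum.distrib w)
    also have "(\<Sum>i<d. of_bool (i = j) * (1 - 2 * w i)) = 1 - 2 * w j"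
      using j by (simp add: of_bool_def if_distrib[of "\<lambda>x. x * _"] cong: if_cong)
    finally show ?thesis by simp
  qed
  \<comment> \<open>For \<open>w j = 1\<close> division by zero yields \<open>s = 0\<close>, and
    both sides vanish.\<close>
  have ss: "s * (s * (2 * (1 - w j))) = 2 * s" unfolding s_def by (cases "w j = 1") (simp_all add: divide_simps)
  have H: "householder d j w = mat d d (\<lambda>(a, b). of_bool (a = b) - s * v a * v b)"
    unfolding householder_def v_def s_def by (auto intro!: cong_mat)
  have "householder d j w * transpose_mat (householder d j w) = 1\<^sub>m d"
  proof (rule eq_matI)
    fix a b assume "a < dim_row (1\<^sub>m d :: real mat)" "b < dim_col (1\<^sub>m d :: real mat)"
    then have ab: "a < d" "b < d" by auto
    have "(householder d j w * transpose_mat (householder d j w)) $$ (a, b) =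
       (\<Sum>l<d. (of_bool (a = l) - s * v a * v l) * (of_bool (b = l) - s * v b * v l))"
      using ab by (simp add: H scalar_prod_def lessThan_atLeast0)
    also have "\<dots> = (\<Sum>l<d. of_bool (a = l) * of_bool (b = l)) - (\<Sum>l<d. of_bool (a = l) * (s * v b * v l))
       - (\<Sum>l<d. of_bool (b = l) * (s * v a * v l)) + (\<Sum>l<d. (s * v a * v b * s) * (v l * v l))"
      by (simp add: algebra_simps sum.distrib sum_subtractf)
    also have "\<dots> = of_bool (a = b) - s * v b * v a - s * v a * v b + (s * v a * v b * s) * (2 * (1 - w j))"
      unfolding sum_distrib_left[symmetric] vv using ab
      by (simp add: of_bool_def if_distrib[of "\<lambda>x. x * _"] cong: if_cong)
    also have "\<dots> = of_bool (a = b) - 2 * s * v a * v b + (s * (s * (2 * (1 - w j)))) * (v a * v b)"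
      by (simp add: algebra_simps)
    also have "\<dots> = 1\<^sub>m d $$ (a, b)" unfolding ss using ab by simp
    finally show "(householder d j w * transpose_mat (householder d j w)) $$ (a, b) = 1\<^sub>m d $$ (a, b)" .
  qed (auto simp: H)
  then show ?thesis unfolding real_orthogonal_mat_def by (simp add: H)
qed

lemma householder_col:
  assumes j: "j < d" and w: "(\<Sum>i<d. (w i)\<^sup>2) = 1" and i: "i < d"
  shows "householder d j w $$ (i, j) = w i"
proof (cases "w j = 1")
  case True
  \<comment> \<open>Unit norm leaves no mass outside position \<open>j\<close>, so \<open>w\<close>
    is the basis vector that the identity matrix has as its column \<open>j\<close>.\<close>
  have "w i = 0" if "i \<noteq> j"
  proof -
    have "(\<Sum>i\<in>{i, j}. (w i)\<^sup>2) \<le> (\<Sum>i<d. (w i)\<^sup>2)"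
      using i j by (intro sum_mono2) auto
    then show ?thesis using that True w by simp
  qed
  then show ?thesis using i j True by (auto simp: householder_def)
next
  case False
  then show ?thesis using i j by (simp add: householder_def)
qed

text \<open>The vector \<open>e_j - w\<close> vanishes at \<open>l\<close>. Applied to spherical
  points, this keeps the columns chosen earlier unchanged.\<close>

lemma householder_other_col:
  assumes "i < d" "l < d" "l \<noteq> j" "w l = 0"
  shows "householder d j w $$ (i, l) = of_bool (i = l)"
  using assms by (simp add: householder_def)

text \<open>The spherical point over the grid point \<open>z\<close>: the rescaled grid coordinates sit in the positions
  \<open>h, \<dots>, 2h - 1\<close>, and the remaining mass in position \<open>j < h\<close>.\<close>
definition sphere_pt :: "nat \<Rightarrow> nat \<Rightarrow> nat \<Rightarrow> (nat \<Rightarrow> nat) \<Rightarrow> nat \<Rightarrow> real" where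
  "sphere_pt h q j z i =
     (if i = j then sqrt (1 - (\<Sum>l<h. (real (z l) / (real q * sqrt (real h)))\<^sup>2))
      else if h \<le> i then real (z (i - h)) / (real q * sqrt (real h)) else 0)"

lemma sum_lessThan_double:
  fixes f :: "nat \<Rightarrow> 'a :: comm_monoid_add"
  shows "(\<Sum>i<2 * h. f i) = (\<Sum>i<h. f i) + (\<Sum>l<h. f (h + l))"
  using sum.atLeastLessThan_concat[of 0 h "h + h" f] sum.shift_bounds_nat_ivl[of f 0 h h]
  by (simp add: mult_2 lessThan_atLeast0 add.commute)

text \<open>Each of the \<open>h\<close> grid coordinates is at most \<open>1 / sqrt h\<close> after
  rescaling, so their squares sum to at most 1 and the root in position \<open>j\<close> has a
  nonnegative argument.\<close>

lemma sphere_pt_norm: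
  assumes j: "j < h" and z: "z \<in> {..<h} \<rightarrow>\<^sub>E {..<q}"
  shows "(\<Sum>i<2 * h. (sphere_pt h q j z i)\<^sup>2) = 1"
proof -
  define Y where "Y = (\<Sum>l<h. (real (z l) / (real q * sqrt (real h)))\<^sup>2)"
  have "Y \<le> (\<Sum>l<h. 1 / real h)"
    unfolding Y_def
  proof (rule sum_mono)
    fix l assume "l \<in> {..<h}"
    then have "z l < q" using z by auto
    then have "(real (z l) / real q)\<^sup>2 \<le> 1" by (simp add: power_le_one)
    then have "(real (z l) / real q)\<^sup>2 * (1 / real h) \<le> 1 * (1 / real h)"
      by (intro mult_right_mono) auto
    then show "(real (z l) / (real q * sqrt (real h)))\<^sup>2 \<le> 1 / real h"
      by (simp add: power_divide power_mult_distrib)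
  qed
  then have Y: "Y \<le> 1" using j by simp
  have "(\<Sum>i<h. (sphere_pt h q j z i)\<^sup>2) = (\<Sum>i<h. if i = j then 1 - Y else 0)"
    using Y by (intro sum.cong refl) (auto simp: sphere_pt_def Y_def)
  moreover have "(\<Sum>l<h. (sphere_pt h q j z (h + l))\<^sup>2) = Y"
    using j unfolding Y_def by (intro sum.cong refl) (auto simp: sphere_pt_def)
  ultimately show ?thesis using j by (simp add: sum_lessThan_double)
qed

section \<open>Orthogonal frames built column by column\<close>

text \<open>The newest grid point stands first, so \<open>length zs\<close> is the index of the
  column being added. The new reflection acts before the earlier ones.\<close>

fun frame_mat :: "nat \<Rightarrow> nat \<Rightarrow> (nat \<Rightarrow> nat) list \<Rightarrow> real mat" where
  "frame_mat h q [] = 1\<^sub>m (2 * h)"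
| "frame_mat h q (z # zs) =
     frame_mat h q zs * householder (2 * h) (length zs) (sphere_pt h q (length zs) z)"

lemma frame_mat_orthogonal:
  assumes "set zs \<subseteq> {..<h} \<rightarrow>\<^sub>E {..<q}" "length zs \<le> h"
  shows "real_orthogonal_mat (2 * h) (frame_mat h q zs)"
  using assms
proof (induction zs)
  case Nil
  then show ?case by (simp add: real_orthogonal_mat_def)
next
  case (Cons z zs)
  then show ?case
    by (auto intro!: real_orthogonal_mat_mult householder_orthogonal sphere_pt_norm)
qed

text \<open>The new reflection fixes the basis vectors with index below \<open>length zs\<close> and
  sends the one with index \<open>length zs\<close> to the spherical point; the earlier reflections
  are then applied to these images.\<close>

lemma frame_mat_Cons_index:
  assumes "set (z # zs) \<subseteq> {..<h} \<rightarrow>\<^sub>E {..<q}" "length zs < h" "i < 2 * h"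
  shows "j < length zs \<Longrightarrow> frame_mat h q (z # zs) $$ (i, j) = frame_mat h q zs $$ (i, j)"
    and "frame_mat h q (z # zs) $$ (i, length zs) =
           (\<Sum>l<2 * h. frame_mat h q zs $$ (i, l) * sphere_pt h q (length zs) z l)"
proof -
  let ?w = "sphere_pt h q (length zs) z"
  have car: "frame_mat h q zs \<in> carrier_mat (2 * h) (2 * h)"
    using frame_mat_orthogonal[of zs h q] assms unfolding real_orthogonal_mat_def by auto
  have H: "householder (2 * h) (length zs) ?w \<in> carrier_mat (2 * h) (2 * h)"
    by (simp add: householder_def)
  have idx: "frame_mat h q (z # zs) $$ (i, j) =
      (\<Sum>l<2 * h. frame_mat h q zs $$ (i, l) * householder (2 * h) (length zs) ?w $$ (l, j))"
    if "j < 2 * h" for j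
    using that car H assms(3) by (auto simp: scalar_prod_def lessThan_atLeast0)
  show "frame_mat h q (z # zs) $$ (i, j) = frame_mat h q zs $$ (i, j)" if "j < length zs"
  proof -
    have "frame_mat h q (z # zs) $$ (i, j) = (\<Sum>l<2 * h. frame_mat h q zs $$ (i, l) * of_bool (l = j))"
      using that assms by (subst idx) (auto intro!: sum.cong simp: householder_other_col sphere_pt_def)
    also have "\<dots> = frame_mat h q zs $$ (i, j)" using that assms by (simp add: of_bool_def if_distrib[of "\<lambda>x. _ * x"] cong: if_cong)
    finally show ?thesis .
  qed
  show "frame_mat h q (z # zs) $$ (i, length zs) = (\<Sum>l<2 * h. frame_mat h q zs $$ (i, l) * ?w l)"
    using assms by (subst idx) (auto intro!: sum.cong householder_col sphere_pt_norm)
qed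

section \<open>Counting frames in a Frobenius ball\<close>

text \<open>Discarding the first \<open>h\<close> coordinates only enlarges the weights, and scaling
  by \<open>q * sqrt h\<close> turns the remaining ones into integers, which leaves a grid
  sum.\<close>

lemma sphere_pt_gauss_sum_le:
  assumes "0 < q" "j < h"
  shows "(\<Sum>z\<in>{..<h} \<rightarrow>\<^sub>E {..<q}. 2 powr - ((real q)\<^sup>2 * real h * (\<Sum>i<2 * h. (sphere_pt h q j z i - a i)\<^sup>2)))
     \<le> 4 ^ h"
proof -
  let ?r = "real q * sqrt (real h)"
  have r: "?r > 0" using assms by auto
  have "(\<Sum>l<h. (real (z l) - ?r * a (h + l))\<^sup>2)
      \<le> (real q)\<^sup>2 * real h * (\<Sum>i<2 * h. (sphere_pt h q j z i - a i)\<^sup>2)" for z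
  proof -
    have "(\<Sum>l<h. (real (z l) - ?r * a (h + l))\<^sup>2) = (\<Sum>l<h. ?r\<^sup>2 * (real (z l) / ?r - a (h + l))\<^sup>2)"
      using r unfolding power_mult_distrib[symmetric] right_diff_distrib
      by (intro sum.cong refl) (use assms in simp)
    also have "\<dots> = ?r\<^sup>2 * (\<Sum>l<h. (sphere_pt h q j z (h + l) - a (h + l))\<^sup>2)"
      using assms by (simp add: sum_distrib_left sphere_pt_def)
    also have "\<dots> \<le> ?r\<^sup>2 * (\<Sum>i<2 * h. (sphere_pt h q j z i - a i)\<^sup>2)"
      by (intro mult_left_mono) (auto simp: sum_lessThan_double intro!: sum_nonneg)
    finally show ?thesis by (simp add: power_mult_distrib)
  qed
  then have "(\<Sum>z\<in>{..<h} \<rightarrow>\<^sub>E {..<q}. 2 powr - ((real q)\<^sup>2 * real h * (\<Sum>i<2 * h. (sphere_pt h q j z i - a i)\<^sup>2)))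
    \<le> (\<Sum>z\<in>{..<h} \<rightarrow>\<^sub>E {..<q}. 2 powr - (\<Sum>l<h. (real (z l) - ?r * a (h + l))\<^sup>2))"
    by (intro sum_mono powr_mono) auto
  also have "\<dots> \<le> 4 ^ h" by (rule grid_theta_sum_le)
  finally show ?thesis .
qed

text \<open>Each new column multiplies the sum by at most \<open>4 ^ h\<close>. The sum over
  \<open>j\<close> runs to \<open>length zs\<close> rather than \<open>h\<close>, so that the weight
  makes sense for the partial frames of the induction.\<close>

lemma frame_mat_gauss_sum_le:
  assumes q: "0 < q"
  shows "(\<Sum>zs | set zs \<subseteq> {..<h} \<rightarrow>\<^sub>E {..<q} \<and> length zs = h.
      2 powr - ((real q)\<^sup>2 * real h * (\<Sum>j<length zs. \<Sum>i<2 * h. (frame_mat h q zs $$ (i, j) - b i j)\<^sup>2)))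
    \<le> (4 ^ h) ^ h"
proof (rule sum_over_lists_le)
  let ?Z = "{..<h} \<rightarrow>\<^sub>E {..<q}"
  let ?D = "\<lambda>zs. \<Sum>j<length zs. \<Sum>i<2 * h. (frame_mat h q zs $$ (i, j) - b i j)\<^sup>2"
  let ?m = "(real q)\<^sup>2 * real h"
  show "finite ?Z" by (intro finite_PiE) auto
  fix zs assume zs: "set zs \<subseteq> ?Z" "length zs < h"
  \<comment> \<open>The target column pulled back by the transpose of the current frame; it does not
    depend on the new point \<open>z\<close>.\<close>
  let ?a = "\<lambda>l. \<Sum>i<2 * h. frame_mat h q zs $$ (i, l) * b i (length zs)"
  have step: "?D (z # zs) = ?D zs + (\<Sum>l<2 * h. (sphere_pt h q (length zs) z l - ?a l)\<^sup>2)" if "z \<in> ?Z" for z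
  proof -
    have "?D (z # zs) = (\<Sum>j<length zs. \<Sum>i<2 * h. (frame_mat h q zs $$ (i, j) - b i j)\<^sup>2)
       + (\<Sum>i<2 * h. ((\<Sum>l<2 * h. frame_mat h q zs $$ (i, l) * sphere_pt h q (length zs) z l) - b i (length zs))\<^sup>2)"
      using frame_mat_Cons_index[of z zs h q] zs that
      by (simp del: frame_mat.simps)
    then show ?thesis
      using frame_mat_orthogonal[of zs h q] zs by (subst (asm) real_orthogonal_mat_dist) auto
  qed
  have "(\<Sum>z\<in>?Z. 2 powr - (?m * ?D (z # zs))) =
      (\<Sum>z\<in>?Z. 2 powr - (?m * ?D zs) * 2 powr - (?m * (\<Sum>l<2 * h. (sphere_pt h q (length zs) z l - ?a l)\<^sup>2)))"
    by (intro sum.cong refl) (simp only: step distrib_left minus_add_distrib powr_add)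
  also have "\<dots> \<le> 2 powr - (?m * ?D zs) * 4 ^ h"
    unfolding sum_distrib_left[symmetric]
    by (intro mult_left_mono sphere_pt_gauss_sum_le q zs) auto
  finally show "(\<Sum>z\<in>?Z. 2 powr - (?m * ?D (z # zs))) \<le> 4 ^ h * 2 powr - (?m * ?D zs)"
    by (simp only: mult.commute)
qed auto

text \<open>An exponential Markov bound: a frame in the ball has Gaussian weight at least
  \<open>2 ^ - (h * h)\<close>, while all weights together are at most \<open>4 ^ (h * h)\<close>.
  The centre \<open>b\<close> is arbitrary.\<close>

lemma frame_mat_ball_count:
  assumes q: "0 < q" and B: "(real q)\<^sup>2 * B \<le> real h"
  shows "real (card {zs. set zs \<subseteq> {..<h} \<rightarrow>\<^sub>E {..<q} \<and> length zs = h \<and>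
      (\<Sum>j<h. \<Sum>i<2 * h. (frame_mat h q zs $$ (i, j) - b i j)\<^sup>2) \<le> B}) \<le> 8 ^ (h * h)"
proof -
  let ?Z = "{..<h} \<rightarrow>\<^sub>E {..<q}"
  let ?D = "\<lambda>zs. \<Sum>j<length zs. \<Sum>i<2 * h. (frame_mat h q zs $$ (i, j) - b i j)\<^sup>2"
  let ?m = "(real q)\<^sup>2 * real h"
  let ?C = "{zs. set zs \<subseteq> ?Z \<and> length zs = h}"
  let ?S = "{zs. set zs \<subseteq> ?Z \<and> length zs = h \<and> (\<Sum>j<h. \<Sum>i<2 * h. (frame_mat h q zs $$ (i, j) - b i j)\<^sup>2) \<le> B}"
  have fin: "finite ?C" by (intro finite_lists_length_eq finite_PiE) auto
  have "real (card ?S) = (\<Sum>zs\<in>?S. 1)" by simp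
  also have "\<dots> \<le> (\<Sum>zs\<in>?S. 2 ^ (h * h) * 2 powr - (?m * ?D zs))"
  proof (rule sum_mono)
    fix zs assume zs: "zs \<in> ?S"
    then have "?m * ?D zs \<le> ?m * B" by (intro mult_left_mono) auto
    also have "\<dots> \<le> real h * real h" using mult_left_mono[OF B, of "real h"] by (simp add: mult_ac)
    finally have "1 \<le> 2 powr (real (h * h) + - (?m * ?D zs))" by (intro ge_one_powr_ge_zero) auto
    then show "1 \<le> 2 ^ (h * h) * 2 powr - (?m * ?D zs)"
      by (simp only: powr_add powr_realpow zero_less_numeral)
  qed
  also have "\<dots> \<le> (\<Sum>zs\<in>?C. 2 ^ (h * h) * 2 powr - (?m * ?D zs))"
    using fin by (intro sum_mono2) auto
  also have "\<dots> \<le> 2 ^ (h * h) * (4 ^ h) ^ h"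
    unfolding sum_distrib_left[symmetric] by (intro mult_left_mono frame_mat_gauss_sum_le q) auto
  also have "\<dots> = 8 ^ (h * h)" by (simp add: power_mult[symmetric] power_mult_distrib[symmetric])
  finally show ?thesis .
qed

section \<open>Expansion of the final state over oracle words\<close>

lemma sum_lessThan_mult:
  fixes f :: "nat \<Rightarrow> 'a :: comm_monoid_add"
  shows "(\<Sum>y<d * M. f y) = (\<Sum>u<M. \<Sum>a<d. f (d * u + a))"
proof -
  have "(\<Sum>y<d * M. f y) = (\<Sum>u<M. sum f {u * d..<u * d + d})"
    by (simp only: sum.nat_group mult.commute)
  also have "\<dots> = (\<Sum>u<M. \<Sum>a<d. f (d * u + a))"
  proof (rule sum.cong[OF refl])
    fix u
    show "sum f {u * d..<u * d + d} = (\<Sum>a<d. f (d * u + a))"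
      using sum.shift_bounds_nat_ivl[of f 0 "u * d" d]
      by (simp add: lessThan_atLeast0 add.commute mult.commute)
  qed
  finally show ?thesis .
qed

text \<open>The sorted list of the first \<open>k\<close> qubits is the identity, so the sum is a
  binary expansion. This turns gates on these qubits into \<open>div\<close> and \<open>mod\<close>
  arithmetic.\<close>

lemma restr_initial: "restr {0..<k} x = x mod 2 ^ k"
proof -
  have "(\<Sum>j<k. if qbit x j then 2 ^ j else 0) = x mod 2 ^ k"
  proof (induction k)
    case (Suc k)
    have "x mod 2 ^ Suc k = 2 ^ k * (x div 2 ^ k mod 2) + x mod 2 ^ k"
      using mod_mult2_eq[of x "2 ^ k" 2] by (simp add: mult.commute)
    then show ?case using Suc by (auto simp: qbit_def odd_iff_mod_2_eq_one even_iff_mod_2_eq_zero)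
  qed simp
  then show ?thesis unfolding restr_def by simp
qed

text \<open>Bits from position \<open>m\<close> on vanish, so agreement below \<open>m\<close>
  already gives agreement at all positions from \<open>k\<close> on.\<close>

lemma high_qbits_eq_iff:
  assumes "x < 2 ^ m" "y < 2 ^ m"
  shows "(\<forall>i<m. i \<notin> {0..<k} \<longrightarrow> qbit x i = qbit y i) \<longleftrightarrow> x div 2 ^ k = y div 2 ^ k"
proof -
  have q: "qbit x i = bit x i" for x i by (simp add: qbit_def bit_iff_odd)
  have z: "\<not> bit x i" if "m \<le> i" "x < 2 ^ m" for x i :: nat
  proof -
    have "x < 2 ^ i" using that by (meson less_le_trans one_le_numeral power_increasing)
    then show ?thesis by (simp add: bit_iff_odd)
  qed
  have "x div 2 ^ k = y div 2 ^ k \<longleftrightarrow> (\<forall>i. bit x (k + i) = bit y (k + i))"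
    by (simp add: bit_eq_iff bit_drop_bit_eq flip: drop_bit_eq_div)
  also have "\<dots> \<longleftrightarrow> (\<forall>i\<ge>k. bit x i = bit y i)"
    by (metis le_add1 le_add_diff_inverse)
  also have "\<dots> \<longleftrightarrow> (\<forall>i<m. i \<notin> {0..<k} \<longrightarrow> bit x i = bit y i)"
    using z assms by (metis atLeastLessThan_iff linorder_not_less zero_le)
  finally show ?thesis by (simp add: q)
qed

lemma act_on_initial_index:
  assumes "x < 2 ^ m" "y < 2 ^ m"
  shows "act_on m {0..<k} V $$ (x, y) =
    (if x div 2 ^ k = y div 2 ^ k then V $$ (x mod 2 ^ k, y mod 2 ^ k) else 0)"
  unfolding act_on_def using assms high_qbits_eq_iff[OF assms, of k] by (simp add: restr_initial)

lemma act_on_carrier: "act_on m S V \<in> carrier_mat (2 ^ m) (2 ^ m)"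
  by (simp add: act_on_def)

lemma act_on_act_on_initial:
  assumes "k \<le> n"
  shows "act_on m {0..<n} (act_on n {0..<k} V) = act_on m {0..<k} V"
proof (rule eq_matI)
  fix x y assume "x < dim_row (act_on m {0..<k} V)" "y < dim_col (act_on m {0..<k} V)"
  then have xy: "x < 2 ^ m" "y < 2 ^ m" by (auto simp: act_on_def)
  have n: "(2::nat) ^ n = 2 ^ k * 2 ^ (n - k)" using assms by (simp flip: power_add)
  have "x div 2 ^ n = y div 2 ^ n \<and> x mod 2 ^ n div 2 ^ k = y mod 2 ^ n div 2 ^ k \<longleftrightarrow>
      x div 2 ^ k = y div 2 ^ k"
  proof -
    have 1: "x div 2 ^ n = x div 2 ^ k div 2 ^ (n - k)" for x :: nat
      unfolding n by (rule div_mult2_eq)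
    have 2: "x mod 2 ^ n div 2 ^ k = x div 2 ^ k mod 2 ^ (n - k)" for x :: nat
      unfolding n by (simp add: mod_mult2_eq)
    show ?thesis unfolding 1 2 by (metis div_mult_mod_eq)
  qed
  moreover have "x mod 2 ^ n mod 2 ^ k = x mod 2 ^ k" for x :: nat
    using assms by (simp add: mod_mod_cancel le_imp_power_dvd)
  ultimately show "act_on m {0..<n} (act_on n {0..<k} V) $$ (x, y) = act_on m {0..<k} V $$ (x, y)"
    using xy by (auto simp: act_on_initial_index)
qed (auto simp: act_on_def)

lemma block_index_less:
  assumes "x < 2 ^ m" "k \<le> m" "b < 2 ^ k"
  shows "2 ^ k * (x div 2 ^ k) + b < (2::nat) ^ m"
proof -
  have m: "(2::nat) ^ m = 2 ^ k * 2 ^ (m - k)" using assms by (simp flip: power_add)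
  then have "x div 2 ^ k < 2 ^ (m - k)"
    using assms(1) by (simp add: less_mult_imp_div_less mult.commute)
  then have "2 ^ k * (x div 2 ^ k) + 2 ^ k \<le> (2::nat) ^ m"
    unfolding m by (metis Suc_leI mult_Suc_right mult_le_mono2 add.commute)
  then show ?thesis using assms(3) by linarith
qed

text \<open>Writing column indices as \<open>2 ^ k * u + b\<close>, only the block
  \<open>u = x div 2 ^ k\<close> contributes.\<close>

lemma act_on_initial_mult_vec:
  assumes "k \<le> m" "x < 2 ^ m" "v \<in> carrier_vec (2 ^ m)"
  shows "(act_on m {0..<k} V *\<^sub>v v) $ x =
     (\<Sum>b<2 ^ k. V $$ (x mod 2 ^ k, b) * v $ (2 ^ k * (x div 2 ^ k) + b))"
proof -
  have m: "(2::nat) ^ m = 2 ^ k * 2 ^ (m - k)" using assms by (simp flip: power_add)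
  have u: "x div 2 ^ k < 2 ^ (m - k)"
    using assms(2) m by (simp add: less_mult_imp_div_less mult.commute)
  have "(act_on m {0..<k} V *\<^sub>v v) $ x = (\<Sum>y<2 ^ m. act_on m {0..<k} V $$ (x, y) * v $ y)"
    using assms act_on_carrier[of m "{0..<k}" V] by (auto simp: scalar_prod_def lessThan_atLeast0)
  also have "\<dots> = (\<Sum>y<2 ^ m. if x div 2 ^ k = y div 2 ^ k then V $$ (x mod 2 ^ k, y mod 2 ^ k) * v $ y else 0)"
    using assms by (intro sum.cong refl) (auto simp: act_on_initial_index)
  also have "\<dots> = (\<Sum>u<2 ^ (m - k). \<Sum>b<2 ^ k. if x div 2 ^ k = u
      then V $$ (x mod 2 ^ k, b) * v $ (2 ^ k * u + b) else 0)"
    unfolding m sum_lessThan_mult by (intro sum.cong refl) auto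
  also have "\<dots> = (\<Sum>u<2 ^ (m - k). if x div 2 ^ k = u then \<Sum>b<2 ^ k.
      V $$ (x mod 2 ^ k, b) * v $ (2 ^ k * u + b) else 0)"
    by (intro sum.cong refl) auto
  also have "\<dots> = (\<Sum>b<2 ^ k. V $$ (x mod 2 ^ k, b) * v $ (2 ^ k * (x div 2 ^ k) + b))"
    using u by simp
  finally show ?thesis .
qed

section \<open>Complex unitary matrices\<close>

lemma mat_adjoint_index:
  fixes A :: "complex mat"
  assumes "A \<in> carrier_mat n n" "i < n" "j < n"
  shows "mat_adjoint A $$ (i, j) = cnj (A $$ (j, i))"
  using assms unfolding mat_adjoint_def by (simp add: mat_of_rows_index)

lemma mat_adjoint_carrier:
  "A \<in> carrier_mat n n \<Longrightarrow> mat_adjoint A \<in> carrier_mat n n"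
  unfolding mat_adjoint_def by auto

lemma unitary_mat_rows:
  assumes "unitary_mat d U" "i < d" "j < d"
  shows "(\<Sum>l<d. U $$ (i, l) * cnj (U $$ (j, l))) = (if i = j then 1 else 0)"
proof -
  have U: "U \<in> carrier_mat d d" "U * mat_adjoint U = 1\<^sub>m d" using assms unfolding unitary_mat_def by auto
  have "(U * mat_adjoint U) $$ (i, j) = (\<Sum>l<d. U $$ (i, l) * cnj (U $$ (j, l)))"
    using assms U(1) mat_adjoint_carrier[OF U(1)]
    by (subst index_mult_mat) (auto simp: scalar_prod_def lessThan_atLeast0 mat_adjoint_index intro!: sum.cong)
  then show ?thesis using assms U by simp
qed

lemma unitary_mat_cols:
  assumes "unitary_mat d U" "i < d" "j < d"
  shows "(\<Sum>l<d. cnj (U $$ (l, i)) * U $$ (l, j)) = (if i = j then 1 else 0)"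
proof -
  have U: "U \<in> carrier_mat d d" "U * mat_adjoint U = 1\<^sub>m d" using assms unfolding unitary_mat_def by auto
  have "(mat_adjoint U * U) $$ (i, j) = (\<Sum>l<d. cnj (U $$ (l, i)) * U $$ (l, j))"
    using assms U(1) mat_adjoint_carrier[OF U(1)]
    by (subst index_mult_mat) (auto simp: scalar_prod_def lessThan_atLeast0 mat_adjoint_index intro!: sum.cong)
  moreover have "mat_adjoint U * U = 1\<^sub>m d"
    using mat_mult_left_right_inverse[OF U(1) mat_adjoint_carrier[OF U(1)] U(2)] .
  ultimately show ?thesis using assms by simp
qed

lemma unitary_mat_sum_squares:
  assumes "unitary_mat d U"
  shows "(\<Sum>i<d. \<Sum>j<d. (cmod (U $$ (i, j)))\<^sup>2) = real d"
proof -
  have "complex_of_real (\<Sum>j<d. (cmod (U $$ (i, j)))\<^sup>2) = 1" if "i < d" for i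
    using unitary_mat_rows[OF assms that that] by (simp add: complex_norm_square del: of_real_power)
  then have "(\<Sum>j<d. (cmod (U $$ (i, j)))\<^sup>2) = 1" if "i < d" for i
    using that of_real_eq_1_iff by blast
  then show ?thesis by simp
qed

lemma unitary_mat_norm:
  assumes "unitary_mat d U"
  shows "(\<Sum>i<d. (cmod (\<Sum>l<d. U $$ (i, l) * f l))\<^sup>2) = (\<Sum>l<d. (cmod (f l))\<^sup>2)"
proof -
  have "complex_of_real (\<Sum>i<d. (cmod (\<Sum>l<d. U $$ (i, l) * f l))\<^sup>2) =
      (\<Sum>i<d. (\<Sum>m<d. U $$ (i, m) * f m) * (\<Sum>l<d. cnj (U $$ (i, l) * f l)))"
    by (simp add: complex_norm_square cnj_sum del: of_real_power)
  also have "\<dots> = (\<Sum>i<d. \<Sum>m<d. \<Sum>l<d. f m * cnj (f l) * (cnj (U $$ (i, l)) * U $$ (i, m)))"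
    unfolding sum_product by (intro sum.cong refl) (simp add: mult_ac)
  also have "\<dots> = (\<Sum>m<d. \<Sum>i<d. \<Sum>l<d. f m * cnj (f l) * (cnj (U $$ (i, l)) * U $$ (i, m)))"
    by (rule sum.swap)
  also have "\<dots> = (\<Sum>m<d. \<Sum>l<d. \<Sum>i<d. f m * cnj (f l) * (cnj (U $$ (i, l)) * U $$ (i, m)))"
    by (intro sum.cong refl sum.swap)
  also have "\<dots> = (\<Sum>m<d. \<Sum>l<d. f m * cnj (f l) * (if l = m then 1 else 0))"
    by (intro sum.cong refl) (simp add: sum_distrib_left[symmetric] unitary_mat_cols[OF assms])
  also have "\<dots> = complex_of_real (\<Sum>l<d. (cmod (f l))\<^sup>2)"
    by (simp add: complex_norm_square if_distrib[of "\<lambda>x. _ * x"] cong: if_cong del: of_real_power)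
  finally show ?thesis using of_real_eq_iff by blast
qed

lemma unitary_mat_of_orthogonal:
  assumes "real_orthogonal_mat d A"
  shows "unitary_mat d (map_mat complex_of_real A)"
proof -
  have A: "A \<in> carrier_mat d d" using assms unfolding real_orthogonal_mat_def by auto
  have "map_mat complex_of_real A * mat_adjoint (map_mat complex_of_real A) = 1\<^sub>m d"
  proof (rule eq_matI)
    fix i j assume "i < dim_row (1\<^sub>m d :: complex mat)" "j < dim_col (1\<^sub>m d :: complex mat)"
    then have ij: "i < d" "j < d" by auto
    have "(map_mat complex_of_real A * mat_adjoint (map_mat complex_of_real A)) $$ (i, j) =
        complex_of_real (\<Sum>l<d. A $$ (i, l) * A $$ (j, l))"
      using ij A mat_adjoint_carrier[of "map_mat complex_of_real A" d]
      by (subst index_mult_mat) (auto simp: scalar_prod_def lessThan_atLeast0 mat_adjoint_index[of _ d] intro!: sum.cong)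
    then show "(map_mat complex_of_real A * mat_adjoint (map_mat complex_of_real A)) $$ (i, j) = 1\<^sub>m d $$ (i, j)"
      using real_orthogonal_mat_rows[OF assms ij] ij by simp
  qed (use A mat_adjoint_carrier[of "map_mat complex_of_real A" d] in auto)
  then show ?thesis using A unfolding unitary_mat_def by auto
qed

text \<open>The part of the final amplitude at \<open>x\<close> in which the successive oracle calls are replaced by the
  matrix units \<open>E\<^sub>a\<^sub>b\<close> listed in the word, latest call first.\<close>
fun path_amp :: "nat \<Rightarrow> nat \<Rightarrow> (nat \<Rightarrow> complex mat) \<Rightarrow> (nat \<times> nat) list \<Rightarrow> nat \<Rightarrow> complex" where
  "path_amp N d W [] x = W 0 $$ (x, 0)"
| "path_amp N d W (ab # w) x = (\<Sum>y<N. W (Suc (length w)) $$ (x, y) *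
     (if y mod d = fst ab then path_amp N d W w (d * (y div d) + snd ab) else 0))"

abbreviation oracle_words :: "nat \<Rightarrow> nat \<Rightarrow> (nat \<times> nat) list set" where
  "oracle_words d t \<equiv> {w. set w \<subseteq> {..<d} \<times> {..<d} \<and> length w = t}"

section \<open>Path expansion of the final state\<close>

lemma sum_oracle_words_Suc:
  "(\<Sum>w\<in>oracle_words d (Suc t). F w) = (\<Sum>a<d. \<Sum>b<d. \<Sum>w\<in>oracle_words d t. F ((a, b) # w))"
proof -
  have eq: "oracle_words d (Suc t) = (\<lambda>(ab, w). ab # w) ` (({..<d} \<times> {..<d}) \<times> oracle_words d t)"
    by (force simp: length_Suc_conv image_iff)
  show ?thesis unfolding eq
    by (subst sum.reindex) (auto simp: inj_on_def sum.cartesian_product' case_prod_unfold)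
qed

lemma alg_state_carrier:
  assumes "\<And>t. t \<le> T \<Longrightarrow> W t \<in> carrier_mat (2 ^ m) (2 ^ m)"
  shows "alg_state n m W U T \<in> carrier_vec (2 ^ m)"
  using assms[of T] by (cases T) (auto intro!: carrier_vecI)

lemma alg_state_eq_path_sum:
  assumes "k \<le> n" "n \<le> m" and W: "\<And>t. t \<le> T \<Longrightarrow> W t \<in> carrier_mat (2 ^ m) (2 ^ m)" and "x < 2 ^ m"
  shows "alg_state n m W (act_on n {0..<k} V) T $ x =
    (\<Sum>w\<in>oracle_words (2 ^ k) T. prod_list (map (($$) V) w) * path_amp (2 ^ m) (2 ^ k) W w x)"
  using W \<open>x < 2 ^ m\<close>
proof (induction T arbitrary: x)
  case 0
  have "oracle_words (2 ^ k) 0 = {[]}" by auto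
  moreover have "W 0 \<in> carrier_mat (2 ^ m) (2 ^ m)" using 0 by auto
  ultimately show ?case using 0
    by (simp add: scalar_prod_right_unit)
next
  case (Suc T)
  let ?N = "(2::nat) ^ m" and ?d = "(2::nat) ^ k"
  let ?psi = "alg_state n m W (act_on n {0..<k} V) T"
  let ?c = "\<lambda>w. prod_list (map (($$) V) w)"
  let ?g = "\<lambda>w y b. path_amp ?N ?d W w (?d * (y div ?d) + b)"
  have km: "k \<le> m" using assms by simp
  have Wc: "W (Suc T) \<in> carrier_mat ?N ?N" using Suc.prems by auto
  have car: "?psi \<in> carrier_vec ?N" using Suc.prems by (intro alg_state_carrier) auto
  have "alg_state n m W (act_on n {0..<k} V) (Suc T) $ x =
      (W (Suc T) *\<^sub>v (act_on m {0..<k} V *\<^sub>v ?psi)) $ x"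
    using assms by (simp add: act_on_act_on_initial)
  also have "\<dots> = (\<Sum>y<?N. W (Suc T) $$ (x, y) * (act_on m {0..<k} V *\<^sub>v ?psi) $ y)"
    using Wc Suc.prems(2) act_on_carrier[of m "{0..<k}" V] by (auto simp: scalar_prod_def lessThan_atLeast0)
  also have "\<dots> = (\<Sum>y<?N. W (Suc T) $$ (x, y) * (\<Sum>b<?d. V $$ (y mod ?d, b) *
       (\<Sum>w\<in>oracle_words ?d T. ?c w * ?g w y b)))"
    using Suc.IH Suc.prems(1) by (intro sum.cong refl arg_cong2[where f = "(*)"])
      (auto simp: act_on_initial_mult_vec[OF km _ car] block_index_less[OF _ km] intro!: sum.cong)
  \<comment> \<open>The row \<open>y mod ?d\<close> is rewritten as a sum over all rows
    \<open>a\<close> with an indicator, so that the pair \<open>(a, b)\<close> can become the head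
    of a longer word.\<close>
  also have "\<dots> = (\<Sum>y<?N. W (Suc T) $$ (x, y) * (\<Sum>a<?d. \<Sum>b<?d. \<Sum>w\<in>oracle_words ?d T.
       V $$ (a, b) * ?c w * (if y mod ?d = a then ?g w y b else 0)))"
  proof (rule sum.cong[OF refl], rule arg_cong2[where f = "(*)", OF refl])
    fix y
    have "(\<Sum>a<?d. \<Sum>b<?d. \<Sum>w\<in>oracle_words ?d T. V $$ (a, b) * ?c w * (if y mod ?d = a then ?g w y b else 0))
      = (\<Sum>a<?d. if y mod ?d = a then \<Sum>b<?d. \<Sum>w\<in>oracle_words ?d T. V $$ (a, b) * ?c w * ?g w y b else 0)"
      by (intro sum.cong refl) auto
    also have "\<dots> = (\<Sum>b<?d. V $$ (y mod ?d, b) * (\<Sum>w\<in>oracle_words ?d T. ?c w * ?g w y b))"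
      by (simp add: sum_distrib_left mult_ac)
    finally show "(\<Sum>b<?d. V $$ (y mod ?d, b) * (\<Sum>w\<in>oracle_words ?d T. ?c w * ?g w y b)) =
      (\<Sum>a<?d. \<Sum>b<?d. \<Sum>w\<in>oracle_words ?d T. V $$ (a, b) * ?c w * (if y mod ?d = a then ?g w y b else 0))" ..
  qed
  also have "\<dots> = (\<Sum>y<?N. \<Sum>w\<in>oracle_words ?d (Suc T).
      W (Suc T) $$ (x, y) * (?c w * (if y mod ?d = fst (hd w) then ?g (tl w) y (snd (hd w)) else 0)))"
    unfolding sum_oracle_words_Suc sum_distrib_left by (intro sum.cong refl) simp
  also have "\<dots> = (\<Sum>w\<in>oracle_words ?d (Suc T). \<Sum>y<?N.
      W (Suc T) $$ (x, y) * (?c w * (if y mod ?d = fst (hd w) then ?g (tl w) y (snd (hd w)) else 0)))"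
    by (rule sum.swap)
  also have "\<dots> = (\<Sum>w\<in>oracle_words ?d (Suc T). ?c w * path_amp ?N ?d W w x)"
    by (intro sum.cong refl) (auto simp: length_Suc_conv sum_distrib_left mult_ac cong: if_cong)
  finally show ?case .
qed

section \<open>Domination of the output probabilities for all oracles at once\<close>

text \<open>The sum factorises over the letters, and each letter contributes the squared Frobenius
  norm \<open>d\<close> of \<open>V\<close>.\<close>

lemma sum_coeff_squares_le:
  assumes "unitary_mat d V"
  shows "(\<Sum>w\<in>oracle_words d T. (cmod (prod_list (map (($$) V) w)))\<^sup>2) \<le> real d ^ T"
proof (rule sum_over_lists_le)
  fix w :: "(nat \<times> nat) list"
  have "(\<Sum>ab\<in>{..<d} \<times> {..<d}. (cmod (prod_list (map (($$) V) (ab # w))))\<^sup>2) =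
      (\<Sum>a<d. \<Sum>b<d. (cmod (V $$ (a, b)))\<^sup>2) * (cmod (prod_list (map (($$) V) w)))\<^sup>2"
    by (simp add: sum.cartesian_product sum_distrib_right norm_mult power_mult_distrib case_prod_unfold)
  then show "(\<Sum>ab\<in>{..<d} \<times> {..<d}. (cmod (prod_list (map (($$) V) (ab # w))))\<^sup>2) \<le>
      real d * (cmod (prod_list (map (($$) V) w)))\<^sup>2"
    using unitary_mat_sum_squares[OF assms] by simp
qed auto

text \<open>The empty word gives a unit vector, a column of \<open>W 0\<close>, and later
  \<open>W\<close> preserve norms. The matrix units with fixed \<open>b\<close> copy the mass of
  component \<open>b\<close> into each of the \<open>d\<close> rows, so one letter multiplies the
  total mass by \<open>d\<close>.\<close>

lemma sum_path_amp_squares_le: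
  assumes W: "\<And>t. t \<le> T \<Longrightarrow> unitary_mat (d * M) (W t)" and "0 < d * M"
  shows "(\<Sum>w\<in>oracle_words d T. \<Sum>x<d * M. (cmod (path_amp (d * M) d W w x))\<^sup>2) \<le> real d ^ T"
proof (rule sum_over_lists_le)
  have "complex_of_real (\<Sum>x<d * M. (cmod (W 0 $$ (x, 0)))\<^sup>2) = 1"
    using unitary_mat_cols[OF W[of 0], of 0 0] assms(2)
    by (simp add: complex_norm_square mult.commute del: of_real_power)
  then have "(\<Sum>x<d * M. (cmod (W 0 $$ (x, 0)))\<^sup>2) = 1" using of_real_eq_1_iff by blast
  then show "(\<Sum>x<d * M. (cmod (path_amp (d * M) d W [] x))\<^sup>2) \<le> 1" by simp
  fix w :: "(nat \<times> nat) list" assume "length w < T"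
  then have U: "unitary_mat (d * M) (W (Suc (length w)))" using W by simp
  let ?p = "\<lambda>y. (cmod (path_amp (d * M) d W w y))\<^sup>2"
  have "(\<Sum>ab\<in>{..<d} \<times> {..<d}. \<Sum>x<d * M. (cmod (path_amp (d * M) d W (ab # w) x))\<^sup>2) =
      (\<Sum>ab\<in>{..<d} \<times> {..<d}. \<Sum>y<d * M. if y mod d = fst ab then ?p (d * (y div d) + snd ab) else 0)"
    by (simp add: unitary_mat_norm[OF U]) (auto intro!: sum.cong)
  also have "\<dots> = (\<Sum>a<d. \<Sum>b<d. \<Sum>u<M. \<Sum>a'<d. if a' = a then ?p (d * u + b) else 0)"
    by (simp add: sum.cartesian_product' sum_lessThan_mult)
  also have "\<dots> = (\<Sum>a<d. \<Sum>u<M. \<Sum>b<d. ?p (d * u + b))"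
    by (simp add: sum.swap[of _ "{..<M}"])
  also have "\<dots> = real d * (\<Sum>y<d * M. ?p y)" by (simp add: sum_lessThan_mult)
  finally show "(\<Sum>ab\<in>{..<d} \<times> {..<d}. \<Sum>x<d * M. (cmod (path_amp (d * M) d W (ab # w) x))\<^sup>2) \<le>
      real d * (\<Sum>y<d * M. ?p y)" by simp
qed auto

text \<open>Cauchy-Schwarz over words separates the coefficients, which depend on \<open>V\<close>,
  from the amplitudes, which do not; the right-hand side is the same for every
  \<open>V\<close>.\<close>

lemma alg_state_square_le:
  assumes "k \<le> n" "query_alg n m T W out" "unitary_mat (2 ^ k) V" "x < 2 ^ m"
  shows "(cmod (alg_state n m W (act_on n {0..<k} V) T $ x))\<^sup>2 \<le>
    2 ^ (k * T) * (\<Sum>w\<in>oracle_words (2 ^ k) T. (cmod (path_amp (2 ^ m) (2 ^ k) W w x))\<^sup>2)"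
proof -
  let ?L = "oracle_words (2 ^ k) T"
  let ?c = "\<lambda>w. prod_list (map (($$) V) w)" and ?p = "\<lambda>w. path_amp (2 ^ m) (2 ^ k) W w x"
  have "alg_state n m W (act_on n {0..<k} V) T $ x = (\<Sum>w\<in>?L. ?c w * ?p w)"
    using assms unfolding query_alg_def unitary_mat_def by (intro alg_state_eq_path_sum) auto
  then have "cmod (alg_state n m W (act_on n {0..<k} V) T $ x) \<le> (\<Sum>w\<in>?L. cmod (?c w) * cmod (?p w))"
    using norm_sum[of "\<lambda>w. ?c w * ?p w" ?L] by (simp add: norm_mult)
  then have "(cmod (alg_state n m W (act_on n {0..<k} V) T $ x))\<^sup>2 \<le> (\<Sum>w\<in>?L. cmod (?c w) * cmod (?p w))\<^sup>2"
    by (intro power_mono) auto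
  also have "\<dots> \<le> (\<Sum>w\<in>?L. (cmod (?c w))\<^sup>2) * (\<Sum>w\<in>?L. (cmod (?p w))\<^sup>2)"
    by (rule Cauchy_Schwarz_ineq_sum)
  also have "\<dots> \<le> real (2 ^ k) ^ T * (\<Sum>w\<in>?L. (cmod (?p w))\<^sup>2)"
    by (intro mult_right_mono sum_coeff_squares_le assms sum_nonneg) auto
  finally show ?thesis by (simp add: power_mult)
qed

text \<open>After exchanging the sums, each outcome is credited to at most \<open>L\<close> members.
  The dominating weights have total mass at most \<open>2 ^ (k * T)\<close> from coefficients times
  \<open>2 ^ (k * T)\<close> from amplitudes.\<close>

lemma sum_success_prob_le:
  assumes "k \<le> n" and alg: "query_alg n m T W out" and fin: "finite C"
    and V: "\<And>c. c \<in> C \<Longrightarrow> unitary_mat (2 ^ k) (V c)"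
    and L: "\<And>x. x < 2 ^ m \<Longrightarrow> real (card {c \<in> C. udist (act_on n {0..<k} (V c)) (out x) \<le> \<epsilon>}) \<le> L"
  shows "(\<Sum>c\<in>C. success_prob n m T W out (act_on n {0..<k} (V c)) \<epsilon>) \<le> L * 4 ^ (k * T)"
proof -
  let ?U = "\<lambda>c. act_on n {0..<k} (V c)"
  let ?Q = "\<lambda>x. \<Sum>w\<in>oracle_words (2 ^ k) T. (cmod (path_amp (2 ^ m) (2 ^ k) W w x))\<^sup>2"
  have L0: "0 \<le> L" using L[of 0] by (meson of_nat_0_le_iff order_trans zero_less_numeral zero_less_power)
  have "(\<Sum>c\<in>C. success_prob n m T W out (?U c) \<epsilon>) \<le>
      (\<Sum>c\<in>C. \<Sum>x<2 ^ m. if udist (?U c) (out x) \<le> \<epsilon> then 2 ^ (k * T) * ?Q x else 0)"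
  proof (rule sum_mono)
    fix c assume c: "c \<in> C"
    have "success_prob n m T W out (?U c) \<epsilon> = (\<Sum>x\<in>{..<2 ^ m} \<inter> {x. udist (?U c) (out x) \<le> \<epsilon>}.
        (cmod (alg_state n m W (?U c) T $ x))\<^sup>2)"
      unfolding success_prob_def by (intro sum.cong) auto
    also have "\<dots> \<le> (\<Sum>x\<in>{..<2 ^ m} \<inter> {x. udist (?U c) (out x) \<le> \<epsilon>}. 2 ^ (k * T) * ?Q x)"
      using assms(1) alg V[OF c] by (intro sum_mono alg_state_square_le) auto
    also have "\<dots> = (\<Sum>x<2 ^ m. if udist (?U c) (out x) \<le> \<epsilon> then 2 ^ (k * T) * ?Q x else 0)"
      by (simp add: sum.If_cases)
    finally show "success_prob n m T W out (?U c) \<epsilon> \<le>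
        (\<Sum>x<2 ^ m. if udist (?U c) (out x) \<le> \<epsilon> then 2 ^ (k * T) * ?Q x else 0)" .
  qed
  also have "\<dots> = (\<Sum>x<2 ^ m. \<Sum>c\<in>C. if udist (?U c) (out x) \<le> \<epsilon> then 2 ^ (k * T) * ?Q x else 0)"
    by (rule sum.swap)
  also have "\<dots> = (\<Sum>x<2 ^ m. real (card {c \<in> C. udist (?U c) (out x) \<le> \<epsilon>}) * (2 ^ (k * T) * ?Q x))"
    using fin by (simp add: sum.If_cases Int_def)
  also have "\<dots> \<le> (\<Sum>x<2 ^ m. L * (2 ^ (k * T) * ?Q x))"
    using L by (intro sum_mono mult_right_mono) (auto intro!: sum_nonneg mult_nonneg_nonneg)
  also have "\<dots> = L * 2 ^ (k * T) * (\<Sum>x<2 ^ m. ?Q x)"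
    by (simp add: sum_distrib_left mult_ac)
  also have "(\<Sum>x<2 ^ m. ?Q x) = (\<Sum>w\<in>oracle_words (2 ^ k) T. \<Sum>x<2 ^ m. (cmod (path_amp (2 ^ m) (2 ^ k) W w x))\<^sup>2)"
    by (rule sum.swap)
  also have "L * 2 ^ (k * T) * \<dots> \<le> L * 2 ^ (k * T) * real (2 ^ k) ^ T"
  proof (intro mult_left_mono)
    have "k \<le> m" using assms(1) alg unfolding query_alg_def by simp
    then have m: "(2::nat) ^ m = 2 ^ k * 2 ^ (m - k)" by (simp flip: power_add)
    show "(\<Sum>w\<in>oracle_words (2 ^ k) T. \<Sum>x<2 ^ m. (cmod (path_amp (2 ^ m) (2 ^ k) W w x))\<^sup>2) \<le> real (2 ^ k) ^ T"
      using alg unfolding query_alg_def m by (intro sum_path_amp_squares_le) auto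
  qed (use L0 in auto)
  also have "\<dots> = L * 4 ^ (k * T)"
    by (simp add: power_mult[symmetric] power_mult_distrib[symmetric])
  finally show ?thesis .
qed

section \<open>Phase-invariant distance and the query bound\<close>

text \<open>Relaxing to the strict bound \<open>2 * \<epsilon>\<close> provides a phase without
  showing that the infimum is attained; the constant is \<open>8 = 2 ^ 2 * 2\<close>.\<close>

lemma udist_leD:
  assumes "udist A B \<le> \<epsilon>" "0 < \<epsilon>" "A \<in> carrier_mat N N" "B \<in> carrier_mat N N" "0 < N"
  shows "\<exists>\<theta>. (\<Sum>x<N. \<Sum>y<N. (cmod (cis \<theta> * A $$ (x, y) - B $$ (x, y)))\<^sup>2) \<le> 8 * \<epsilon>\<^sup>2 * real N"
proof -
  have "udist A B < 2 * \<epsilon>" using assms by linarith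
  moreover have "0 \<in> {0..<2 * pi}" by simp
  ultimately obtain \<theta> where th:
    "frob_norm (exp (\<i> * of_real \<theta>) \<cdot>\<^sub>m A - B) / sqrt (2 * real (dim_row A)) < 2 * \<epsilon>"
    unfolding udist_def by (fastforce dest!: cInf_lessD[rotated])
  define S where "S = (\<Sum>x<N. \<Sum>y<N. (cmod (cis \<theta> * A $$ (x, y) - B $$ (x, y)))\<^sup>2)"
  have "frob_norm (exp (\<i> * of_real \<theta>) \<cdot>\<^sub>m A - B) = sqrt S"
    using assms unfolding frob_norm_def S_def by (simp add: cis_conv_exp)
  then have "sqrt S \<le> 2 * \<epsilon> * sqrt (2 * real N)"
    using th assms by (simp add: pos_divide_less_eq)
  then have "(sqrt S)\<^sup>2 \<le> (2 * \<epsilon> * sqrt (2 * real N))\<^sup>2"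
    by (intro power_mono) (auto simp: S_def intro!: sum_nonneg)
  then have "S \<le> 8 * \<epsilon>\<^sup>2 * real N"
    by (simp add: S_def sum_nonneg power_mult_distrib)
  then show ?thesis unfolding S_def by blast
qed

lemma cmod_diff_square_le:
  "(cmod (a - b))\<^sup>2 \<le> 2 * (cmod (a - c))\<^sup>2 + 2 * (cmod (b - c))\<^sup>2"
proof -
  have "cmod (a - b) \<le> cmod (a - c) + cmod (b - c)"
    by (metis norm_triangle_sub dist_norm dist_triangle2)
  then have "(cmod (a - b))\<^sup>2 \<le> (cmod (a - c) + cmod (b - c))\<^sup>2" by (intro power_mono) auto
  also have "\<dots> \<le> 2 * (cmod (a - c))\<^sup>2 + 2 * (cmod (b - c))\<^sup>2"
    using sum_squares_ge_zero[of "cmod (a - c) - cmod (b - c)" 0]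
    by (simp add: power2_eq_square algebra_simps)
  finally show ?thesis .
qed

text \<open>Both matrices are block diagonal with \<open>2 ^ (n - k)\<close> identical
  blocks.\<close>

lemma sum_act_on_initial_diff:
  assumes "k \<le> n"
  shows "(\<Sum>x<2 ^ n. \<Sum>y<2 ^ n. (cmod (s * act_on n {0..<k} A $$ (x, y) - t * act_on n {0..<k} B $$ (x, y)))\<^sup>2) =
    2 ^ (n - k) * (\<Sum>a<2 ^ k. \<Sum>b<2 ^ k. (cmod (s * A $$ (a, b) - t * B $$ (a, b)))\<^sup>2)"
proof -
  have n: "(2::nat) ^ n = 2 ^ k * 2 ^ (n - k)" using assms by (simp flip: power_add)
  let ?g = "\<lambda>a b. (cmod (s * A $$ (a, b) - t * B $$ (a, b)))\<^sup>2"
  have "(\<Sum>x<2 ^ n. \<Sum>y<2 ^ n. (cmod (s * act_on n {0..<k} A $$ (x, y) - t * act_on n {0..<k} B $$ (x, y)))\<^sup>2) =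
      (\<Sum>x<2 ^ n. \<Sum>y<2 ^ n. if x div 2 ^ k = y div 2 ^ k then ?g (x mod 2 ^ k) (y mod 2 ^ k) else 0)"
    by (intro sum.cong refl) (auto simp: act_on_initial_index)
  also have "\<dots> = (\<Sum>u<(2::nat) ^ (n - k). \<Sum>a<2 ^ k. \<Sum>u'<(2::nat) ^ (n - k). \<Sum>b<2 ^ k. if u = u' then ?g a b else 0)"
    unfolding n sum_lessThan_mult by (intro sum.cong refl) auto
  also have "\<dots> = (\<Sum>u<(2::nat) ^ (n - k). \<Sum>a<2 ^ k. \<Sum>u'<(2::nat) ^ (n - k). if u = u' then \<Sum>b<2 ^ k. ?g a b else 0)"
    by (intro sum.cong refl) auto
  also have "\<dots> = 2 ^ (n - k) * (\<Sum>a<2 ^ k. \<Sum>b<2 ^ k. ?g a b)" by simp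
  finally show ?thesis .
qed

lemma cmod_cis_diff_square:
  "(cmod (cis \<theta> * complex_of_real a - cis \<phi> * complex_of_real b))\<^sup>2 = a\<^sup>2 + b\<^sup>2 - 2 * cos (\<theta> - \<phi>) * (a * b)"
proof -
  have "(cmod (cis \<theta> * complex_of_real a - cis \<phi> * complex_of_real b))\<^sup>2 =
      a\<^sup>2 * ((cos \<theta>)\<^sup>2 + (sin \<theta>)\<^sup>2) + b\<^sup>2 * ((cos \<phi>)\<^sup>2 + (sin \<phi>)\<^sup>2) - 2 * cos (\<theta> - \<phi>) * (a * b)"
    unfolding cmod_power2 cos_diff
    by (simp add: power2_eq_square algebra_simps del: sin_cos_squared_add sin_cos_squared_add2 sin_cos_squared_add3)
  then show ?thesis by simp
qed

text \<open>For real matrices the optimal global phase is a sign.\<close>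
lemma orthogonal_phase_dist:
  assumes A: "real_orthogonal_mat d A" and B: "real_orthogonal_mat d B"
    and le: "(\<Sum>i<d. \<Sum>j<d. (cmod (cis \<theta> * complex_of_real (A $$ (i, j)) - cis \<phi> * complex_of_real (B $$ (i, j))))\<^sup>2) \<le> r"
  shows "(\<Sum>i<d. \<Sum>j<d. (A $$ (i, j) - B $$ (i, j))\<^sup>2) \<le> r \<or> (\<Sum>i<d. \<Sum>j<d. (A $$ (i, j) + B $$ (i, j))\<^sup>2) \<le> r"
proof -
  \<comment> \<open>Both matrices have squared norm \<open>d\<close>, so the inner product
    \<open>t\<close> alone determines all these distances.\<close>
  define t where "t = (\<Sum>i<d. \<Sum>j<d. A $$ (i, j) * B $$ (i, j))"
  have gen: "(\<Sum>i<d. \<Sum>j<d. (A $$ (i, j))\<^sup>2 + (B $$ (i, j))\<^sup>2 - 2 * c * (A $$ (i, j) * B $$ (i, j))) = 2 * real d - 2 * c * t" for c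
    unfolding t_def sum_subtractf sum.distrib sum_distrib_left[symmetric]
    using real_orthogonal_mat_sum_squares[OF A] real_orthogonal_mat_sum_squares[OF B] by simp
  have "2 * real d - 2 * cos (\<theta> - \<phi>) * t \<le> r"
    using le unfolding cmod_cis_diff_square gen .
  moreover have "cos (\<theta> - \<phi>) * t \<le> \<bar>t\<bar>"
    using mult_right_mono[OF abs_cos_le_one[of "\<theta> - \<phi>"], of "\<bar>t\<bar>"] abs_ge_self[of "cos (\<theta> - \<phi>) * t"]
    by (simp add: abs_mult)
  moreover have "(\<Sum>i<d. \<Sum>j<d. (A $$ (i, j) - B $$ (i, j))\<^sup>2) = 2 * real d - 2 * t"
    using gen[of 1] by (simp add: power2_diff mult.assoc)
  moreover have "(\<Sum>i<d. \<Sum>j<d. (A $$ (i, j) + B $$ (i, j))\<^sup>2) = 2 * real d + 2 * t"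
    using gen[of "-1"] by (simp add: power2_sum mult.assoc)
  ultimately show ?thesis by (cases "t \<ge> 0") auto
qed

text \<open>The common neighbour \<open>V\<close> is eliminated by the triangle inequality, each
  side keeping its own phase; \<open>32 = 2 * 8 + 2 * 8\<close>, and the factor
  \<open>2 ^ (n - k)\<close> cancels.\<close>

lemma close_juntas_dist:
  assumes "k \<le> n" "0 < \<epsilon>" "real_orthogonal_mat (2 ^ k) A" "real_orthogonal_mat (2 ^ k) B" "V \<in> carrier_mat (2 ^ n) (2 ^ n)"
    and UA: "udist (act_on n {0..<k} (map_mat complex_of_real A)) V \<le> \<epsilon>"
    and UB: "udist (act_on n {0..<k} (map_mat complex_of_real B)) V \<le> \<epsilon>"
  shows "(\<Sum>i<2 ^ k. \<Sum>j<2 ^ k. (A $$ (i, j) - B $$ (i, j))\<^sup>2) \<le> 32 * \<epsilon>\<^sup>2 * 2 ^ k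
     \<or> (\<Sum>i<2 ^ k. \<Sum>j<2 ^ k. (A $$ (i, j) + B $$ (i, j))\<^sup>2) \<le> 32 * \<epsilon>\<^sup>2 * 2 ^ k"
proof -
  let ?N = "(2::nat) ^ n" and ?d = "(2::nat) ^ k"
  let ?A = "map_mat complex_of_real A" and ?B = "map_mat complex_of_real B"
  let ?UA = "act_on n {0..<k} ?A" and ?UB = "act_on n {0..<k} ?B"
  obtain \<theta> where th: "(\<Sum>x<?N. \<Sum>y<?N. (cmod (cis \<theta> * ?UA $$ (x, y) - V $$ (x, y)))\<^sup>2) \<le> 8 * \<epsilon>\<^sup>2 * real ?N"
    using udist_leD[OF UA assms(2) act_on_carrier assms(5)] by auto
  obtain \<phi> where ph: "(\<Sum>x<?N. \<Sum>y<?N. (cmod (cis \<phi> * ?UB $$ (x, y) - V $$ (x, y)))\<^sup>2) \<le> 8 * \<epsilon>\<^sup>2 * real ?N"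
    using udist_leD[OF UB assms(2) act_on_carrier assms(5)] by auto
  have N: "real ?N = 2 ^ (n - k) * 2 ^ k" using assms(1) by (simp flip: power_add)
  have "2 ^ (n - k) * (\<Sum>a<?d. \<Sum>b<?d. (cmod (cis \<theta> * ?A $$ (a, b) - cis \<phi> * ?B $$ (a, b)))\<^sup>2) =
      (\<Sum>x<?N. \<Sum>y<?N. (cmod (cis \<theta> * ?UA $$ (x, y) - cis \<phi> * ?UB $$ (x, y)))\<^sup>2)"
    using sum_act_on_initial_diff[OF assms(1)] by simp
  also have "\<dots> \<le> (\<Sum>x<?N. \<Sum>y<?N. 2 * (cmod (cis \<theta> * ?UA $$ (x, y) - V $$ (x, y)))\<^sup>2 +
       2 * (cmod (cis \<phi> * ?UB $$ (x, y) - V $$ (x, y)))\<^sup>2)"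
    by (intro sum_mono cmod_diff_square_le)
  also have "\<dots> = 2 * (\<Sum>x<?N. \<Sum>y<?N. (cmod (cis \<theta> * ?UA $$ (x, y) - V $$ (x, y)))\<^sup>2) +
       2 * (\<Sum>x<?N. \<Sum>y<?N. (cmod (cis \<phi> * ?UB $$ (x, y) - V $$ (x, y)))\<^sup>2)"
    by (simp add: sum.distrib sum_distrib_left)
  also have "\<dots> \<le> 2 ^ (n - k) * (32 * \<epsilon>\<^sup>2 * 2 ^ k)"
    using th ph unfolding N by (simp add: mult_ac)
  finally have "(\<Sum>a<?d. \<Sum>b<?d. (cmod (cis \<theta> * ?A $$ (a, b) - cis \<phi> * ?B $$ (a, b)))\<^sup>2) \<le> 32 * \<epsilon>\<^sup>2 * 2 ^ k"
    by (subst (asm) mult_le_cancel_left_pos) auto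
  then have "(\<Sum>a<?d. \<Sum>b<?d. (cmod (cis \<theta> * complex_of_real (A $$ (a, b)) - cis \<phi> * complex_of_real (B $$ (a, b))))\<^sup>2)
      \<le> 32 * \<epsilon>\<^sup>2 * 2 ^ k"
    using carrier_matD[of A ?d ?d] carrier_matD[of B ?d ?d] assms(3,4)[unfolded real_orthogonal_mat_def]
    by simp
  then show ?thesis by (rule orthogonal_phase_dist[OF assms(3,4)])
qed

text \<open>The ball count for frames sees only the first \<open>h\<close> columns.\<close>

lemma sum_first_columns_le:
  fixes f :: "nat \<Rightarrow> nat \<Rightarrow> real"
  assumes "(\<Sum>i<2 * h. \<Sum>j<2 * h. (f i j)\<^sup>2) \<le> B"
  shows "(\<Sum>j<h. \<Sum>i<2 * h. (f i j)\<^sup>2) \<le> B"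
proof -
  have "(\<Sum>j<h. \<Sum>i<2 * h. (f i j)\<^sup>2) \<le> (\<Sum>j<2 * h. \<Sum>i<2 * h. (f i j)\<^sup>2)"
    by (intro sum_mono2) (auto intro!: sum_nonneg)
  also have "\<dots> = (\<Sum>i<2 * h. \<Sum>j<2 * h. (f i j)\<^sup>2)" by (rule sum.swap)
  finally show ?thesis using assms by simp
qed

section \<open>From the packing bound to the query bound\<close>

text \<open>One member \<open>zs0\<close> near \<open>V\<close> serves as centre. Every other member
  near \<open>V\<close> is close to its matrix or to the negative of it, so two real balls suffice,
  whence the factor 2.\<close>

lemma frame_juntas_close_count:
  assumes "k \<le> n" "0 < \<epsilon>" and h: "2 ^ k = 2 * h" and q: "0 < q" "real q * (8 * \<epsilon>) \<le> 1"
    and V: "V \<in> carrier_mat (2 ^ n) (2 ^ n)"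
  shows "real (card {zs \<in> {zs. set zs \<subseteq> {..<h} \<rightarrow>\<^sub>E {..<q} \<and> length zs = h}.
     udist (act_on n {0..<k} (map_mat complex_of_real (frame_mat h q zs))) V \<le> \<epsilon>}) \<le> 2 * 8 ^ (h * h)"
    (is "real (card ?S) \<le> _")
proof (cases "?S = {}")
  case True
  then show ?thesis by (simp only: card.empty) simp
next
  case False
  let ?C = "{zs. set zs \<subseteq> {..<h} \<rightarrow>\<^sub>E {..<q} \<and> length zs = h}"
  let ?B = "32 * \<epsilon>\<^sup>2 * 2 ^ k"
  from False obtain zs0 where zs0: "zs0 \<in> ?S" by blast
  let ?b = "\<lambda>i j. frame_mat h q zs0 $$ (i, j)"
  let ?P = "\<lambda>b. {zs. set zs \<subseteq> {..<h} \<rightarrow>\<^sub>E {..<q} \<and> length zs = h \<and>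
      (\<Sum>j<h. \<Sum>i<2 * h. (frame_mat h q zs $$ (i, j) - b i j)\<^sup>2) \<le> ?B}"
  have fin: "finite ?C" by (intro finite_lists_length_eq finite_PiE) auto
  then have finP: "finite (?P b)" for b by (rule rev_finite_subset) auto
  have orth: "real_orthogonal_mat (2 ^ k) (frame_mat h q zs)" if "zs \<in> ?C" for zs
    using frame_mat_orthogonal[of zs h q] that h by auto
  have "?S \<subseteq> ?P ?b \<union> ?P (\<lambda>i j. - ?b i j)"
  proof
    fix zs assume zs: "zs \<in> ?S"
    have "(\<Sum>i<2 ^ k. \<Sum>j<2 ^ k. (frame_mat h q zs $$ (i, j) - ?b i j)\<^sup>2) \<le> ?B
        \<or> (\<Sum>i<2 ^ k. \<Sum>j<2 ^ k. (frame_mat h q zs $$ (i, j) + ?b i j)\<^sup>2) \<le> ?B"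
      using zs zs0 orth by (intro close_juntas_dist[OF assms(1,2) _ _ V]) auto
    then have "(\<Sum>j<h. \<Sum>i<2 * h. (frame_mat h q zs $$ (i, j) - ?b i j)\<^sup>2) \<le> ?B
        \<or> (\<Sum>j<h. \<Sum>i<2 * h. (frame_mat h q zs $$ (i, j) + ?b i j)\<^sup>2) \<le> ?B"
      unfolding h
      using sum_first_columns_le[of "\<lambda>i j. frame_mat h q zs $$ (i, j) - ?b i j" h]
        sum_first_columns_le[of "\<lambda>i j. frame_mat h q zs $$ (i, j) + ?b i j" h] by blast
    then show "zs \<in> ?P ?b \<union> ?P (\<lambda>i j. - ?b i j)" using zs by auto
  qed
  then have "card ?S \<le> card (?P ?b \<union> ?P (\<lambda>i j. - ?b i j))"
    by (intro card_mono finite_UnI finP)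
  also have "\<dots> \<le> card (?P ?b) + card (?P (\<lambda>i j. - ?b i j))" by (rule card_Un_le)
  finally have "real (card ?S) \<le> real (card (?P ?b)) + real (card (?P (\<lambda>i j. - ?b i j)))" by linarith
  \<comment> \<open>As \<open>2 ^ k = 2 * h\<close> and \<open>32 * 2 = 8 ^ 2\<close>, the left side
    equals \<open>(real q * (8 * \<epsilon>)) ^ 2 * h\<close>.\<close>
  moreover have "(real q)\<^sup>2 * ?B \<le> real h"
  proof -
    have "(real q * (8 * \<epsilon>))\<^sup>2 \<le> 1" using q assms(2) by (simp add: power_le_one)
    then have "(real q * (8 * \<epsilon>))\<^sup>2 * real h \<le> 1 * real h" by (intro mult_right_mono) auto
    moreover have "(2::real) ^ k = 2 * real h" using h by (metis of_nat_mult of_nat_numeral of_nat_power)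
    ultimately show ?thesis by (simp add: power_mult_distrib mult_ac)
  qed
  ultimately show ?thesis
    using frame_mat_ball_count[OF q(1), of ?B h ?b] frame_mat_ball_count[OF q(1), of ?B h "\<lambda>i j. - ?b i j"]
    by linarith
qed

lemma quantum_junta_frame:
  assumes "k \<le> n" "2 ^ k = 2 * h" "set zs \<subseteq> {..<h} \<rightarrow>\<^sub>E {..<q}" "length zs = h"
  shows "quantum_junta n k (act_on n {0..<k} (map_mat complex_of_real (frame_mat h q zs)))"
  unfolding quantum_junta_def
  using assms frame_mat_orthogonal[of zs h q]
  by (intro exI[of _ "{0..<k}"] exI conjI) (auto intro: unitary_mat_of_orthogonal)

text \<open>Success probabilities are summed over the whole family. Family size and ball bound both
  count lists, so coinciding matrices would carry the same multiplicity on both sides.\<close>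

lemma learner_counting_bound:
  assumes "k \<le> n" "0 < \<epsilon>" "2 ^ k = 2 * h" "0 < q" "real q * (8 * \<epsilon>) \<le> 1"
    and alg: "query_alg n m T W out"
    and succ: "\<And>U. quantum_junta n k U \<Longrightarrow> p \<le> success_prob n m T W out U \<epsilon>"
  shows "p * real q ^ (h * h) \<le> 2 * 8 ^ (h * h) * 4 ^ (k * T)"
proof -
  let ?C = "{zs. set zs \<subseteq> {..<h} \<rightarrow>\<^sub>E {..<q} \<and> length zs = h}"
  let ?V = "\<lambda>zs. map_mat complex_of_real (frame_mat h q zs)"
  have fin: "finite ({..<h} \<rightarrow>\<^sub>E {..<q})" by (intro finite_PiE) auto
  have card: "real (card ?C) = real q ^ (h * h)"
    using card_lists_length_eq[OF fin, of h] by (simp add: card_PiE power_mult)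
  have "p * real (card ?C) = (\<Sum>zs\<in>?C. p)" by simp
  also have "\<dots> \<le> (\<Sum>zs\<in>?C. success_prob n m T W out (act_on n {0..<k} (?V zs)) \<epsilon>)"
    using assms by (intro sum_mono succ quantum_junta_frame) auto
  also have "\<dots> \<le> 2 * 8 ^ (h * h) * 4 ^ (k * T)"
  proof (rule sum_success_prob_le[OF assms(1) alg])
    show "finite ?C" by (rule finite_lists_length_eq[OF fin])
    show "unitary_mat (2 ^ k) (?V zs)" if "zs \<in> ?C" for zs
      using that assms frame_mat_orthogonal[of zs h q] by (intro unitary_mat_of_orthogonal) auto
    fix x :: nat assume "x < 2 ^ m"
    then have "out x \<in> carrier_mat (2 ^ n) (2 ^ n)"
      using alg unfolding query_alg_def unitary_mat_def by blast
    then show "real (card {zs \<in> ?C. udist (act_on n {0..<k} (?V zs)) (out x) \<le> \<epsilon>}) \<le> 2 * 8 ^ (h * h)"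
      using assms by (intro frame_juntas_close_count)
  qed
  finally show ?thesis unfolding card .
qed

text \<open>Take logarithms in the counting bound; for small \<open>\<epsilon>\<close> the constant
  terms use up at most half of \<open>ln (1 / \<epsilon>)\<close>.\<close>

lemma learner_query_bound:
  assumes p: "0 < p" "p \<le> 1" and k: "1 \<le> k" "k \<le> n" and \<epsilon>: "0 < \<epsilon>" "\<epsilon> \<le> p\<^sup>2 / 65536"
    and alg: "query_alg n m T W out"
    and succ: "\<And>U. quantum_junta n k U \<Longrightarrow> p \<le> success_prob n m T W out U \<epsilon>"
  shows "1 / (8 * ln 4) * 4 ^ k * ln (1 / \<epsilon>) / real k \<le> real T"
proof -
  define h where "h = (2::nat) ^ (k - 1)"
  define q where "q = nat \<lfloor>1 / (8 * \<epsilon>)\<rfloor>"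
  have h: "2 ^ k = 2 * h" using k unfolding h_def by (cases k) auto
  have h1: "1 \<le> h" unfolding h_def by simp
  have "p\<^sup>2 \<le> 1" using p by (simp add: power_le_one)
  then have e16: "\<epsilon> \<le> 1 / 16" using \<epsilon> by simp
  have "1 / (8 * \<epsilon>) \<ge> 2" using e16 \<epsilon> by (simp add: field_simps)
  then have q: "real q \<le> 1 / (8 * \<epsilon>)" "1 / (8 * \<epsilon>) - 1 \<le> real q" "0 < q"
    unfolding q_def by linarith+
  have q8: "real q * (8 * \<epsilon>) \<le> 1" using q(1) \<epsilon> by (simp add: field_simps)
  \<comment> \<open>Rounding down loses at most 1, which is at most half of
    \<open>1 / (8 * \<epsilon>)\<close> because that number is at least 2.\<close>
  have q16: "1 / (16 * \<epsilon>) \<le> real q"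
    using q(2) e16 \<epsilon> by (simp add: field_simps)
  have "p * (1 / (16 * \<epsilon>)) ^ (h * h) \<le> p * real q ^ (h * h)"
    using p q16 \<epsilon> by (intro mult_left_mono power_mono) auto
  also have "\<dots> \<le> 2 * 8 ^ (h * h) * 4 ^ (k * T)"
    using learner_counting_bound[OF k(2) \<epsilon>(1) h q(3) q8 alg succ] by blast
  finally have main: "p * (1 / (16 * \<epsilon>)) ^ (h * h) \<le> 2 * 8 ^ (h * h) * 4 ^ (k * T)" .
  have "ln (p * (1 / (16 * \<epsilon>)) ^ (h * h)) \<le> ln (2 * 8 ^ (h * h) * 4 ^ (k * T))"
    using main p \<epsilon> by (subst ln_le_cancel_iff) auto
  then have ln_main: "ln p + real (h * h) * (ln (1 / \<epsilon>) - ln 16) \<le> ln 2 + real (h * h) * ln 8 + real (k * T) * ln 4"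
    using p \<epsilon> by (simp add: ln_mult ln_div ln_realpow algebra_simps)
  \<comment> \<open>The threshold is \<open>(p / 256) ^ 2\<close> with
    \<open>256 = 16 * 8 * 2\<close>: the factors absorb the rounding, the ball count and the sign,
    and the square yields the half.\<close>
  have "ln \<epsilon> \<le> ln (p\<^sup>2 / 65536)" using \<epsilon> p by (subst ln_le_cancel_iff) auto
  also have "\<dots> = 2 * ln p - 2 * ln 256"
    using p ln_realpow[of "256::real" 2] by (simp add: ln_div ln_realpow)
  also have "ln (256::real) = ln 16 + ln 8 + ln 2"
    using ln_mult[of "16::real" 8] ln_mult[of "128::real" 2] by simp
  finally have eps: "ln 16 + ln 8 + (ln 2 - ln p) \<le> ln (1 / \<epsilon>) / 2"
    using \<epsilon> by (simp add: ln_div)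
  have hh: "1 \<le> real (h * h)" using h1 by (metis mult_le_mono nat_mult_1 of_nat_1 of_nat_mono)
  have "0 \<le> ln 2 - ln p" using p by (simp add: ln_le_zero_iff order_trans)
  \<comment> \<open>The term that does not scale with \<open>h * h\<close> is enlarged so that the
    whole estimate shares this factor.\<close>
  then have "ln 2 - ln p \<le> real (h * h) * (ln 2 - ln p)" using mult_right_mono[OF hh] by fastforce
  moreover have "real (h * h) * (ln 16 + ln 8 + (ln 2 - ln p)) \<le> real (h * h) * (ln (1 / \<epsilon>) / 2)"
    by (intro mult_left_mono eps) auto
  ultimately have "real (h * h) * (ln (1 / \<epsilon>) / 2) \<le> real (k * T) * ln 4"
    using ln_main by (simp add: algebra_simps)
  \<comment> \<open>This 4 and the lost half make up the 8 in the constant.\<close>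
  moreover have "4 ^ k = 4 * real (h * h)"
    using arg_cong[OF h, of "\<lambda>x. real (x * x)"] by (simp flip: power_mult_distrib)
  ultimately have "4 ^ k * ln (1 / \<epsilon>) \<le> real T * (8 * ln 4 * real k)"
    by (simp add: mult_ac)
  then show ?thesis using k by (simp add: field_simps)
qed

theorem mainTheorem6:
  shows "\<forall>p::real. 0 < p \<and> p \<le> 1 \<longrightarrow>
    (\<exists>c::real > 0. \<exists>\<epsilon>0::real > 0.
      \<forall>n k m T W out (\<epsilon>::real).
        1 \<le> k \<longrightarrow> k \<le> n \<longrightarrow> 0 < \<epsilon> \<longrightarrow> \<epsilon> \<le> \<epsilon>0 \<longrightarrow>
        query_alg n m T W out \<longrightarrow>
        (\<forall>U. quantum_junta n k U \<longrightarrow> success_prob n m T W out U \<epsilon> \<ge> p) \<longrightarrow>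
        real T \<ge> c * 4 ^ k * ln (1 / \<epsilon>) / real k)"
proof (intro allI impI)
  fix p :: real assume p: "0 < p \<and> p \<le> 1"
  \<comment> \<open>The constant \<open>c\<close> is absolute; only the threshold for
    \<open>\<epsilon>\<close> depends on \<open>p\<close>.\<close>
  then have "0 < 1 / (8 * ln (4::real))" "0 < p\<^sup>2 / 65536" by auto
  then show "\<exists>c::real > 0. \<exists>\<epsilon>0::real > 0.
      \<forall>n k m T W out (\<epsilon>::real).
        1 \<le> k \<longrightarrow> k \<le> n \<longrightarrow> 0 < \<epsilon> \<longrightarrow> \<epsilon> \<le> \<epsilon>0 \<longrightarrow>
        query_alg n m T W out \<longrightarrow>
        (\<forall>U. quantum_junta n k U \<longrightarrow> success_prob n m T W out U \<epsilon> \<ge> p) \<longrightarrow>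
        real T \<ge> c * 4 ^ k * ln (1 / \<epsilon>) / real k"
    using learner_query_bound p by blast
qed

end
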